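(* Let $G_1,G_2$ be groups and let $H_1$, $H_2$ be subgroups of $G_1$ and $G_2$ respectively. The following are equivalent: (i) $\mathbb{M}(H_1^\star)$ and $\mathbb{M}(H_2^\star)$ are unitarily equivalent. (ii) $\mathbb{M}(H_1^\star)$ and $\mathbb{M}(H_2^\star)$ are $*$-isomorphic. (iii) $H_1$ and $H_2$ have the same cardinality and the same indices in $G_1$, $G_2$ respectively, i.e. $|H_1|=|H_2|$ and $[G_1:H_1]=[G_2:H_2]$.
   Context: For a group $G$, $\ell^2(G)$ is the Hilbert space of square-summable functions $G\to\mathbb{C}$ ($G$ regarded as a discrete group). For $A\subseteq G$, $M_A\in B(\ell^2(G))$ is the projection given by multiplication by the characteristic function $\chi_A$. For $\Omega\subseteq G\times G$, with complement $\Omega^c$ in $G\times G$, $$\mathbb{M}(\Omega)=\{T\in B(\ell^2(G)): M_FTM_E=0\text{ for all }E,F\subseteq G\text{ with }E\times F\subseteq\Omega^c\}.$$ For $E\subseteq G$, $E^\star=\{(g,h)\in G\times G: g^{-1}h\in E\}$. When $H$ is a subgroup of $G$, $\mathbb{M}(H^\star)$ is a von Neumann algebra acting on $\ell^2(G)$. Here $H_i^\star\subseteq G_i\times G_i$ and $\mathbb{M}(H_i^\star)\subseteq B(\ell^2(G_i))$. Unitarily equivalent means there is a unitary $U:\ell^2(G_1)\to\ell^2(G_2)$ with $\mathbb{M}(H_2^\star)=U\,\mathbb{M}(H_1^\star)\,U^*$. Groups need not be finite or countable; $|\cdot|$ and $[G_i:H_i]$ (the cardinality of the set of left cosets) are cardinal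 numbers. *)

theory Defs
  imports "HOL-Analysis.Analysis" "HOL-Algebra.Left_Coset"
begin

text \<open>
  The Hilbert space $\ell^2(X)$ of a set \<open>X\<close>, which may be a proper subset of its type.
  Its elements are represented by total functions that vanish outside \<open>X\<close>, so that equality in
  $\ell^2(X)$ is equality of functions.
\<close>

definition ell2 :: "'a set \<Rightarrow> ('a \<Rightarrow> complex) set" where
  "ell2 X = {f. (\<forall>x. x \<notin> X \<longrightarrow> f x = 0) \<and> (\<lambda>x. (cmod (f x))\<^sup>2) summable_on X}"

definition ell2_inner :: "'a set \<Rightarrow> ('a \<Rightarrow> complex) \<Rightarrow> ('a \<Rightarrow> complex) \<Rightarrow> complex" where
  "ell2_inner X f g = (\<Sum>\<^sub>\<infinity>x\<in>X. f x * cnj (g x))"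

definition ell2_norm :: "'a set \<Rightarrow> ('a \<Rightarrow> complex) \<Rightarrow> real" where
  "ell2_norm X f = sqrt (\<Sum>\<^sub>\<infinity>x\<in>X. (cmod (f x))\<^sup>2)"

text \<open>
  Bounded operators from $\ell^2(X)$ to $\ell^2(Y)$. They are extensional, that is, \<open>undefined\<close>
  outside \<open>ell2 X\<close>, so that equality of operators is equality of functions.
\<close>

definition bounded_ops :: "'a set \<Rightarrow> 'b set \<Rightarrow> (('a \<Rightarrow> complex) \<Rightarrow> ('b \<Rightarrow> complex)) set" where
  "bounded_ops X Y = {T. T \<in> ell2 X \<rightarrow>\<^sub>E ell2 Y \<and>
     (\<forall>f\<in>ell2 X. \<forall>g\<in>ell2 X. T (\<lambda>x. f x + g x) = (\<lambda>y. T f y + T g y)) \<and>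
     (\<forall>c. \<forall>f\<in>ell2 X. T (\<lambda>x. c * f x) = (\<lambda>y. c * T f y)) \<and>
     (\<exists>K. \<forall>f\<in>ell2 X. ell2_norm Y (T f) \<le> K * ell2_norm X f)}"

definition zero_op :: "'a set \<Rightarrow> ('a \<Rightarrow> complex) \<Rightarrow> ('b \<Rightarrow> complex)" where
  "zero_op X = (\<lambda>f\<in>ell2 X. \<lambda>_. 0)"

definition id_op :: "'a set \<Rightarrow> ('a \<Rightarrow> complex) \<Rightarrow> ('a \<Rightarrow> complex)" where
  "id_op X = (\<lambda>f\<in>ell2 X. f)"

definition add_op :: "'a set \<Rightarrow> (('a \<Rightarrow> complex) \<Rightarrow> ('b \<Rightarrow> complex)) \<Rightarrow>
    (('a \<Rightarrow> complex) \<Rightarrow> ('b \<Rightarrow> complex)) \<Rightarrow> ('a \<Rightarrow> complex) \<Rightarrow> ('b \<Rightarrow> complex)" where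
  "add_op X S T = (\<lambda>f\<in>ell2 X. \<lambda>y. S f y + T f y)"

definition scale_op :: "'a set \<Rightarrow> complex \<Rightarrow> (('a \<Rightarrow> complex) \<Rightarrow> ('b \<Rightarrow> complex)) \<Rightarrow>
    ('a \<Rightarrow> complex) \<Rightarrow> ('b \<Rightarrow> complex)" where
  "scale_op X c T = (\<lambda>f\<in>ell2 X. \<lambda>y. c * T f y)"

text \<open>\<open>mult_op X S T\<close> is the product $ST$, where \<open>X\<close> indexes the domain $\ell^2(X)$ of $T$.\<close>

definition mult_op :: "'a set \<Rightarrow> (('b \<Rightarrow> complex) \<Rightarrow> ('c \<Rightarrow> complex)) \<Rightarrow>
    (('a \<Rightarrow> complex) \<Rightarrow> ('b \<Rightarrow> complex)) \<Rightarrow> ('a \<Rightarrow> complex) \<Rightarrow> ('c \<Rightarrow> complex)" where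
  "mult_op X S T = compose (ell2 X) S T"

definition adjoint_op :: "'a set \<Rightarrow> 'b set \<Rightarrow> (('a \<Rightarrow> complex) \<Rightarrow> ('b \<Rightarrow> complex)) \<Rightarrow>
    ('b \<Rightarrow> complex) \<Rightarrow> ('a \<Rightarrow> complex)" where
  "adjoint_op X Y T = (THE S. S \<in> bounded_ops Y X \<and>
     (\<forall>f\<in>ell2 X. \<forall>g\<in>ell2 Y. ell2_inner Y (T f) g = ell2_inner X f (S g)))"

definition unitary_op :: "'a set \<Rightarrow> 'b set \<Rightarrow> (('a \<Rightarrow> complex) \<Rightarrow> ('b \<Rightarrow> complex)) \<Rightarrow> bool" where
  "unitary_op X Y U \<longleftrightarrow> U \<in> bounded_ops X Y \<and>
     mult_op X (adjoint_op X Y U) U = id_op X \<and>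
     mult_op Y U (adjoint_op X Y U) = id_op Y"

text \<open>The projection $M_A \in B(\ell^2(X))$.\<close>

definition proj_op :: "'a set \<Rightarrow> 'a set \<Rightarrow> ('a \<Rightarrow> complex) \<Rightarrow> ('a \<Rightarrow> complex)" where
  "proj_op X A = (\<lambda>f\<in>ell2 X. \<lambda>x. indicator A x * f x)"

text \<open>$\mathbb{M}(\Omega)$ for $\Omega \subseteq X \times X$.\<close>

definition supp_ops :: "'a set \<Rightarrow> ('a \<times> 'a) set \<Rightarrow>
    (('a \<Rightarrow> complex) \<Rightarrow> ('a \<Rightarrow> complex)) set" where
  "supp_ops X \<Omega> = {T \<in> bounded_ops X X. \<forall>E F. E \<subseteq> X \<longrightarrow> F \<subseteq> X \<longrightarrow> E \<times> F \<subseteq> (X \<times> X) - \<Omega> \<longrightarrow>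
     mult_op X (proj_op X F) (mult_op X T (proj_op X E)) = zero_op X}"

text \<open>$E^\star$ for a subset \<open>E\<close> of the group \<open>G\<close>.\<close>

definition star_set :: "('a, 'm) monoid_scheme \<Rightarrow> 'a set \<Rightarrow> ('a \<times> 'a) set" where
  "star_set G E = {(g, h) \<in> carrier G \<times> carrier G. inv\<^bsub>G\<^esub> g \<otimes>\<^bsub>G\<^esub> h \<in> E}"

definition unitarily_equivalent :: "'a set \<Rightarrow> 'b set \<Rightarrow> (('a \<Rightarrow> complex) \<Rightarrow> ('a \<Rightarrow> complex)) set \<Rightarrow>
    (('b \<Rightarrow> complex) \<Rightarrow> ('b \<Rightarrow> complex)) set \<Rightarrow> bool" where
  "unitarily_equivalent X Y \<A> \<B> \<longleftrightarrow> (\<exists>U. unitary_op X Y U \<and>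
     \<B> = (\<lambda>T. mult_op Y U (mult_op Y T (adjoint_op X Y U))) ` \<A>)"

definition star_isomorphic :: "'a set \<Rightarrow> 'b set \<Rightarrow> (('a \<Rightarrow> complex) \<Rightarrow> ('a \<Rightarrow> complex)) set \<Rightarrow>
    (('b \<Rightarrow> complex) \<Rightarrow> ('b \<Rightarrow> complex)) set \<Rightarrow> bool" where
  "star_isomorphic X Y \<A> \<B> \<longleftrightarrow> (\<exists>\<phi>. bij_betw \<phi> \<A> \<B> \<and>
     (\<forall>S\<in>\<A>. \<forall>T\<in>\<A>. \<phi> (add_op X S T) = add_op Y (\<phi> S) (\<phi> T)) \<and>
     (\<forall>c. \<forall>T\<in>\<A>. \<phi> (scale_op X c T) = scale_op Y c (\<phi> T)) \<and>
     (\<forall>S\<in>\<A>. \<forall>T\<in>\<A>. \<phi> (mult_op X S T) = mult_op Y (\<phi> S) (\<phi> T)) \<and>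
     (\<forall>T\<in>\<A>. \<phi> (adjoint_op X X T) = adjoint_op Y Y (\<phi> T)))"

end

theory Submission
  imports Defs
begin

text \<open>
  The relation $H^\star$ says that two group elements lie in the same left coset of $H$, so an operator
  belongs to $\mathbb{M}(H^\star)$ if and only if its matrix is block diagonal with respect to the
  partition of $G$ into left cosets. Thus $\mathbb{M}(H^\star)$ is a direct sum, over the $[G:H]$
  cosets, of copies of $B(\ell^2(H))$. The theorem says that the two cardinals that enter this
  description are invariants. The lemmas treat $\mathbb{M}(R)$ for an arbitrary equivalence
  relation $R$ on a set, with its classes in place of the cosets.

  If the cardinals agree, then there is a bijection of the groups that maps cosets onto cosets
  (\<open>equiv_isomorphism_from_classes\<close>), and the corresponding permutation of the basis is a unitary
  which conjugates one algebra into the other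
  (\<open>relation_isomorphism_imp_unitarily_equivalent\<close>). Conjugation by a unitary is a
  star-isomorphism (\<open>unitarily_equivalent_imp_star_isomorphic\<close>).

  It remains to recover the cardinals from the star-algebra. A projection $p \neq 0$ in
  $\mathbb{M}(R)$ with $p\,\mathbb{M}(R)\,p = \mathbb{C}p$ projects to the line of a vector supported
  in one class (\<open>minimal_projection_rank_one\<close>). The projections to the basis vectors are of this
  kind, hence so are their images under a star-isomorphism. They yield an orthonormal family of
  vectors $\xi_x$, each supported in a class $D_x$, and $D_x = D_{x'}$ holds if and only if $x$ and $x'$
  are equivalent, since this can be read off from $e_{x'}\,\mathbb{M}(R)\,e_x \neq 0$
  (\<open>star_isomorphism_class_map\<close>). So there are at least as many classes on the other side, and a
  class $C$ labels an orthonormal family in $\ell^2(D)$ for some class $D$, which forces $|C| \le |D|$ by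
  Bessel's inequality (\<open>orthonormal_lepoll\<close>). The inverse of the star-isomorphism gives the
  opposite inequalities, and the Schroeder-Bernstein theorem concludes.
\<close>

section \<open>The Hilbert space of square-summable functions\<close>

definition ket :: "'a \<Rightarrow> 'a \<Rightarrow> complex" where
  "ket x = (\<lambda>y. of_bool (y = x))"

lemma ell2I:
  assumes "\<And>x. x \<notin> X \<Longrightarrow> f x = 0" and "(\<lambda>x. (cmod (f x))\<^sup>2) summable_on X"
  shows "f \<in> ell2 X"
  using assms by (auto simp: ell2_def)

lemma ell2_outside: "f \<in> ell2 X \<Longrightarrow> x \<notin> X \<Longrightarrow> f x = 0"
  by (auto simp: ell2_def)

lemma ell2_summable: "f \<in> ell2 X \<Longrightarrow> (\<lambda>x. (cmod (f x))\<^sup>2) summable_on X"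
  by (auto simp: ell2_def)

lemma ell2_zero [simp]: "(\<lambda>_. 0) \<in> ell2 X"
  by (auto intro: ell2I)

lemma ell2_scale: "f \<in> ell2 X \<Longrightarrow> (\<lambda>x. c * f x) \<in> ell2 X"
  by (auto intro!: ell2I summable_on_cmult_right simp: ell2_outside ell2_summable norm_mult power_mult_distrib)

lemma ell2_add:
  assumes "f \<in> ell2 X" "g \<in> ell2 X"
  shows "(\<lambda>x. f x + g x) \<in> ell2 X"
proof (rule ell2I)
  show "(\<lambda>x. (cmod (f x + g x))\<^sup>2) summable_on X"
  proof (rule summable_on_comparison_test)
    show "(\<lambda>x. 2 * (cmod (f x))\<^sup>2 + 2 * (cmod (g x))\<^sup>2) summable_on X"
      by (intro summable_on_add summable_on_cmult_right ell2_summable assms)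
    show "(cmod (f x + g x))\<^sup>2 \<le> 2 * (cmod (f x))\<^sup>2 + 2 * (cmod (g x))\<^sup>2" for x
    proof -
      have "(cmod (f x + g x))\<^sup>2 \<le> (cmod (f x) + cmod (g x))\<^sup>2"
        by (intro power_mono norm_triangle_ineq) auto
      also have "\<dots> \<le> 2 * (cmod (f x))\<^sup>2 + 2 * (cmod (g x))\<^sup>2"
        using sum_squares_bound[of "cmod (f x)" "cmod (g x)"] by (simp add: power2_sum)
      finally show ?thesis .
    qed
  qed auto
qed (simp add: assms[THEN ell2_outside])

lemma ell2_uminus: "f \<in> ell2 X \<Longrightarrow> (\<lambda>x. - f x) \<in> ell2 X"
  using ell2_scale[of f X "-1"] by simp

lemma ell2_diff:
  assumes "f \<in> ell2 X" "g \<in> ell2 X"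
  shows "(\<lambda>x. f x - g x) \<in> ell2 X"
  using ell2_add[OF assms(1) ell2_uminus[OF assms(2)]] by simp

lemma ell2_sum:
  assumes "\<And>i. i \<in> I \<Longrightarrow> v i \<in> ell2 X"
  shows "(\<lambda>x. \<Sum>i\<in>I. c i * v i x) \<in> ell2 X"
  using assms by (induction I rule: infinite_finite_induct) (simp_all add: ell2_add ell2_scale)

lemma ell2_restrict:
  assumes "f \<in> ell2 X"
  shows "(\<lambda>x. if x \<in> A then f x else 0) \<in> ell2 X"
  by (rule ell2I) (auto simp: ell2_outside[OF assms]
      intro: summable_on_comparison_test[OF ell2_summable[OF assms]])

lemma ell2_ket: "x \<in> X \<Longrightarrow> ket x \<in> ell2 X"
  by (rule ell2I) (auto simp: ket_def summable_on_def
      intro!: exI[of _ 1] has_sum_finite_neutralI[of "{x}"])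

lemma ell2_inner_summable:
  assumes "f \<in> ell2 X" "g \<in> ell2 X"
  shows "(\<lambda>x. f x * cnj (g x)) summable_on X"
proof -
  have "(\<lambda>x. norm (f x * cnj (g x))) summable_on X"
  proof (rule Infinite_Sum.abs_summable_on_comparison_test')
    show "(\<lambda>x. (cmod (f x))\<^sup>2 + (cmod (g x))\<^sup>2) summable_on X"
      by (intro summable_on_add ell2_summable assms)
    show "cmod (f x * cnj (g x)) \<le> (cmod (f x))\<^sup>2 + (cmod (g x))\<^sup>2" for x
      using sum_squares_bound[of "cmod (f x)" "cmod (g x)"]
        mult_nonneg_nonneg[OF norm_ge_zero[of "f x"] norm_ge_zero[of "g x"]]
      unfolding norm_mult complex_mod_cnj by linarith
  qed
  then show ?thesis by (rule abs_summable_summable)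
qed

lemma ell2_inner_has_sum:
  assumes "f \<in> ell2 X" "g \<in> ell2 X"
  shows "((\<lambda>x. f x * cnj (g x)) has_sum ell2_inner X f g) X"
  unfolding ell2_inner_def using ell2_inner_summable[OF assms] by simp

lemma ell2_inner_add_left:
  assumes "f \<in> ell2 X" "g \<in> ell2 X" "h \<in> ell2 X"
  shows "ell2_inner X (\<lambda>x. f x + g x) h = ell2_inner X f h + ell2_inner X g h"
  unfolding ell2_inner_def by (simp add: distrib_right infsum_add ell2_inner_summable assms)

lemma ell2_inner_scale_left: "ell2_inner X (\<lambda>x. c * f x) h = c * ell2_inner X f h"
  unfolding ell2_inner_def by (simp add: mult.assoc infsum_cmult_right')

lemma ell2_inner_cnj: "cnj (ell2_inner X f g) = ell2_inner X g f"
  unfolding ell2_inner_def infsum_cnj[symmetric] by (simp add: mult.commute del: infsum_cnj)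

lemma ell2_inner_scale_right: "ell2_inner X h (\<lambda>x. c * f x) = cnj c * ell2_inner X h f"
  using arg_cong[OF ell2_inner_scale_left[of X c f h], of cnj] by (simp add: ell2_inner_cnj)

lemma ell2_inner_zero_left [simp]: "ell2_inner X (\<lambda>_. 0) f = 0"
  by (simp add: ell2_inner_def)

lemma ell2_inner_zero_right [simp]: "ell2_inner X f (\<lambda>_. 0) = 0"
  by (simp add: ell2_inner_def)

lemma ell2_inner_diff_left:
  assumes "f \<in> ell2 X" "g \<in> ell2 X" "h \<in> ell2 X"
  shows "ell2_inner X (\<lambda>x. f x - g x) h = ell2_inner X f h - ell2_inner X g h"
  using ell2_inner_add_left[OF assms(1) ell2_uminus[OF assms(2)] assms(3)]
    ell2_inner_scale_left[of X "-1" g h] by simp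

lemma ell2_inner_sum_left:
  assumes "\<And>i. i \<in> I \<Longrightarrow> v i \<in> ell2 X" "h \<in> ell2 X"
  shows "ell2_inner X (\<lambda>x. \<Sum>i\<in>I. c i * v i x) h = (\<Sum>i\<in>I. c i * ell2_inner X (v i) h)"
  using assms(1)
  by (induction I rule: infinite_finite_induct)
    (simp_all add: ell2_inner_add_left ell2_scale ell2_sum ell2_inner_scale_left assms(2))

lemma ell2_inner_ket:
  assumes "f \<in> ell2 X" "x \<in> X"
  shows "ell2_inner X f (ket x) = f x"
  unfolding ell2_inner_def
  by (rule infsumI, rule has_sum_finite_neutralI[of "{x}"]) (auto simp: ket_def assms)

lemma ell2_eqI:
  assumes "f \<in> ell2 X" "g \<in> ell2 X" "\<And>h. h \<in> ell2 X \<Longrightarrow> ell2_inner X h f = ell2_inner X h g"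
  shows "f = g"
proof
  fix x show "f x = g x"
    using assms(3)[OF ell2_ket, of x] ell2_inner_ket[OF assms(1)] ell2_inner_ket[OF assms(2)] assms(1,2)
    by (cases "x \<in> X") (metis ell2_inner_cnj, simp add: ell2_outside)
qed

lemma ell2_norm_nonneg [simp]: "ell2_norm X f \<ge> 0"
  by (simp add: ell2_norm_def infsum_nonneg)

lemma ell2_norm_zero [simp]: "ell2_norm X (\<lambda>_. 0) = 0"
  by (simp add: ell2_norm_def)

lemma ell2_norm_square: "(ell2_norm X f)\<^sup>2 = (\<Sum>\<^sub>\<infinity>x\<in>X. (cmod (f x))\<^sup>2)"
  by (simp add: ell2_norm_def infsum_nonneg)

lemma ell2_inner_self:
  assumes "f \<in> ell2 X"
  shows "ell2_inner X f f = of_real ((ell2_norm X f)\<^sup>2)"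
  unfolding ell2_norm_square ell2_inner_def complex_norm_square[symmetric]
  using has_sum_of_real[OF has_sum_infsum[OF ell2_summable[OF assms]], where ?'a = complex]
  by (intro infsumI) simp

lemma ell2_norm_scale: "ell2_norm X (\<lambda>x. c * f x) = cmod c * ell2_norm X f"
  by (simp add: ell2_norm_def norm_mult power_mult_distrib infsum_cmult_right' real_sqrt_mult)

lemma coordinate_le_norm:
  assumes "f \<in> ell2 X" shows "cmod (f x) \<le> ell2_norm X f"
proof (cases "x \<in> X")
  case True
  have "(cmod (f x))\<^sup>2 \<le> (ell2_norm X f)\<^sup>2"
    unfolding ell2_norm_square
    using finite_sum_le_infsum[OF ell2_summable[OF assms], of "{x}"] True by simp
  then show ?thesis by (rule power2_le_imp_le) simp
qed (simp add: ell2_outside[OF assms])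

lemma ell2_norm_eq_0:
  assumes "f \<in> ell2 X" "ell2_norm X f = 0" shows "f = (\<lambda>_. 0)"
  using coordinate_le_norm[OF assms(1)] assms(2) by (auto intro!: ext)

lemma ell2_cauchy_schwarz:
  assumes f: "f \<in> ell2 X" and g: "g \<in> ell2 X"
  shows "cmod (ell2_inner X f g) \<le> ell2_norm X f * ell2_norm X g"
proof (cases "ell2_norm X g = 0")
  case True
  then show ?thesis using ell2_norm_eq_0[OF g] by simp
next
  case False
  define s where "s = (ell2_norm X g)\<^sup>2"
  have s: "s > 0" using False by (simp add: s_def)
  \<comment> \<open>\<open>c g\<close> is the orthogonal projection of \<open>f\<close> to the line through \<open>g\<close>;
      the claim is that the remainder \<open>f - c g\<close> has nonnegative square norm.\<close>
  define c where "c = ell2_inner X f g / of_real s"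
  let ?h = "\<lambda>x. f x - c * g x"
  have cg: "(\<lambda>x. c * g x) \<in> ell2 X" by (rule ell2_scale[OF g])
  have h: "?h \<in> ell2 X" by (rule ell2_diff[OF f cg])
  have "ell2_inner X ?h g = ell2_inner X f g - c * of_real s"
    by (simp only: ell2_inner_diff_left[OF f cg g] ell2_inner_scale_left ell2_inner_self[OF g] s_def)
  also have "\<dots> = 0" using s by (simp add: c_def)
  finally have "ell2_inner X ?h g = 0" .
  then have "ell2_inner X g ?h = 0" by (metis ell2_inner_cnj complex_cnj_zero)
  then have "ell2_inner X ?h ?h = ell2_inner X f ?h"
    by (simp add: ell2_inner_diff_left[OF f cg h] ell2_inner_scale_left)
  also have "\<dots> = cnj (ell2_inner X ?h f)" by (simp add: ell2_inner_cnj)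
  also have "\<dots> = ell2_inner X f f - cnj c * ell2_inner X f g"
    by (simp add: ell2_inner_diff_left[OF f cg f] ell2_inner_scale_left ell2_inner_cnj)
  also have "\<dots> = of_real ((ell2_norm X f)\<^sup>2 - (cmod (ell2_inner X f g))\<^sup>2 / s)"
    using complex_norm_square[of "ell2_inner X f g"] s by (simp add: ell2_inner_self[OF f] c_def field_simps)
  finally have "(ell2_norm X ?h)\<^sup>2 = (ell2_norm X f)\<^sup>2 - (cmod (ell2_inner X f g))\<^sup>2 / s"
    unfolding ell2_inner_self[OF h] using of_real_eq_iff by blast
  then have "(cmod (ell2_inner X f g))\<^sup>2 / s \<le> (ell2_norm X f)\<^sup>2"
    using zero_le_power2[of "ell2_norm X ?h"] by linarith
  then have "(cmod (ell2_inner X f g))\<^sup>2 \<le> (ell2_norm X f * ell2_norm X g)\<^sup>2"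
    using s by (simp add: divide_le_eq power_mult_distrib s_def)
  then show ?thesis by (rule power2_le_imp_le) simp
qed

lemma ell2_norm_triangle:
  assumes f: "f \<in> ell2 X" and g: "g \<in> ell2 X"
  shows "ell2_norm X (\<lambda>x. f x + g x) \<le> ell2_norm X f + ell2_norm X g"
proof -
  let ?h = "\<lambda>x. f x + g x"
  have h: "?h \<in> ell2 X" by (rule ell2_add[OF f g])
  have "ell2_norm X ?h * ell2_norm X ?h = cmod (ell2_inner X ?h ?h)"
    unfolding ell2_inner_self[OF h] norm_of_real by (simp add: power2_eq_square)
  also have "\<dots> \<le> cmod (ell2_inner X f ?h) + cmod (ell2_inner X g ?h)"
    unfolding ell2_inner_add_left[OF f g h] by (rule norm_triangle_ineq)
  also have "\<dots> \<le> (ell2_norm X f + ell2_norm X g) * ell2_norm X ?h"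
    unfolding distrib_right by (intro add_mono ell2_cauchy_schwarz f g h)
  finally show ?thesis
    using ell2_norm_nonneg[of X ?h] ell2_norm_nonneg[of X f] ell2_norm_nonneg[of X g]
    by (metis add_nonneg_nonneg mult_right_le_imp_le order_le_less)
qed

lemma restrict_finite_eq_sum:
  assumes "finite F"
  shows "(\<lambda>x. if x \<in> F then f x else 0) = (\<lambda>x. \<Sum>i\<in>F. f i * ket i x)"
  using assms by (auto simp: ket_def fun_eq_iff of_bool_def if_distrib sum.delta cong: if_cong)

lemma norm_tail_square:
  assumes f: "f \<in> ell2 X" and F: "finite F" "F \<subseteq> X"
  shows "(ell2_norm X (\<lambda>x. f x - (if x \<in> F then f x else 0)))\<^sup>2
    = (ell2_norm X f)\<^sup>2 - (\<Sum>x\<in>F. (cmod (f x))\<^sup>2)"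
proof -
  have "((\<lambda>x. - (if x \<in> F then (cmod (f x))\<^sup>2 else 0)) has_sum - (\<Sum>x\<in>F. (cmod (f x))\<^sup>2)) X"
    by (rule has_sum_finite_neutralI[OF F]) (auto simp: sum_negf)
  from has_sum_add[OF has_sum_infsum[OF ell2_summable[OF f]] this]
  have "((\<lambda>x. (cmod (f x - (if x \<in> F then f x else 0)))\<^sup>2) has_sum
      ((ell2_norm X f)\<^sup>2 - (\<Sum>x\<in>F. (cmod (f x))\<^sup>2))) X"
    unfolding ell2_norm_square diff_conv_add_uminus by (rule has_sum_cong[THEN iffD1, rotated]) auto
  then show ?thesis unfolding ell2_norm_square by (rule infsumI)
qed

text \<open>
  Finitely supported vectors are dense: the square norm of a tail is the difference between a
  convergent sum and its partial sum. Density turns identities of bounded operators on the basis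
  \<open>ket x\<close> into identities on the whole space.
\<close>

lemma norm_tail_tendsto:
  assumes f: "f \<in> ell2 X"
  shows "((\<lambda>F. ell2_norm X (\<lambda>x. f x - (if x \<in> F then f x else 0))) \<longlongrightarrow> 0)
    (finite_subsets_at_top X)"
proof -
  have "((\<lambda>x. (cmod (f x))\<^sup>2) has_sum (ell2_norm X f)\<^sup>2) X"
    unfolding ell2_norm_square using ell2_summable[OF f] by simp
  then have "(sum (\<lambda>x. (cmod (f x))\<^sup>2) \<longlongrightarrow> (ell2_norm X f)\<^sup>2) (finite_subsets_at_top X)"
    by (simp add: has_sum_def)
  then have "((\<lambda>F. sqrt ((ell2_norm X f)\<^sup>2 - (\<Sum>x\<in>F. (cmod (f x))\<^sup>2)))
      \<longlongrightarrow> sqrt ((ell2_norm X f)\<^sup>2 - (ell2_norm X f)\<^sup>2)) (finite_subsets_at_top X)"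
    by (intro tendsto_intros)
  moreover have "sqrt ((ell2_norm X f)\<^sup>2 - (\<Sum>x\<in>F. (cmod (f x))\<^sup>2))
      = ell2_norm X (\<lambda>x. f x - (if x \<in> F then f x else 0))" if "finite F \<and> F \<subseteq> X" for F
    using norm_tail_square[OF f, of F, symmetric] that by simp
  ultimately show ?thesis
    by (auto elim!: Lim_transform_eventually intro!: eventually_finite_subsets_at_top_weakI)
qed

section \<open>Bounded operators, their matrices and adjoints\<close>

lemma op_in: "T \<in> bounded_ops X Y \<Longrightarrow> f \<in> ell2 X \<Longrightarrow> T f \<in> ell2 Y"
  by (auto simp: bounded_ops_def)

lemma op_add:
  "T \<in> bounded_ops X Y \<Longrightarrow> f \<in> ell2 X \<Longrightarrow> g \<in> ell2 X \<Longrightarrow> T (\<lambda>x. f x + g x) = (\<lambda>y. T f y + T g y)"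
  by (simp add: bounded_ops_def)

lemma op_scale:
  "T \<in> bounded_ops X Y \<Longrightarrow> f \<in> ell2 X \<Longrightarrow> T (\<lambda>x. c * f x) = (\<lambda>y. c * T f y)"
  by (simp add: bounded_ops_def)

lemma op_bounded:
  assumes "T \<in> bounded_ops X Y"
  obtains K where "K \<ge> 0" "\<And>f. f \<in> ell2 X \<Longrightarrow> ell2_norm Y (T f) \<le> K * ell2_norm X f"
proof -
  obtain K where K: "\<And>f. f \<in> ell2 X \<Longrightarrow> ell2_norm Y (T f) \<le> K * ell2_norm X f"
    using assms by (fastforce simp: bounded_ops_def)
  have "ell2_norm Y (T f) \<le> \<bar>K\<bar> * ell2_norm X f" if "f \<in> ell2 X" for f
    using K[OF that] mult_right_mono[OF abs_ge_self[of K] ell2_norm_nonneg[of X f]] by linarith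
  with that[of "\<bar>K\<bar>"] show ?thesis by simp
qed

lemma bounded_opsI:
  assumes "\<And>f. f \<in> ell2 X \<Longrightarrow> T f \<in> ell2 Y" "\<And>f. f \<notin> ell2 X \<Longrightarrow> T f = undefined"
    and "\<And>f g. f \<in> ell2 X \<Longrightarrow> g \<in> ell2 X \<Longrightarrow> T (\<lambda>x. f x + g x) = (\<lambda>y. T f y + T g y)"
    and "\<And>c f. f \<in> ell2 X \<Longrightarrow> T (\<lambda>x. c * f x) = (\<lambda>y. c * T f y)"
    and "\<And>f. f \<in> ell2 X \<Longrightarrow> ell2_norm Y (T f) \<le> K * ell2_norm X f"
  shows "T \<in> bounded_ops X Y"
  using assms unfolding bounded_ops_def PiE_def extensional_def by blast

lemma op_eqI:
  assumes "S \<in> bounded_ops X Y" "T \<in> bounded_ops X Y" "\<And>f. f \<in> ell2 X \<Longrightarrow> S f = T f"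
  shows "S = T"
  using assms by (auto simp: bounded_ops_def intro!: PiE_ext[of S "ell2 X" "\<lambda>_. ell2 Y" T])

lemma op_zero: "T \<in> bounded_ops X Y \<Longrightarrow> T (\<lambda>_. 0) = (\<lambda>_. 0)"
  using op_scale[of T X Y "\<lambda>_. 0" 0] by simp

lemma op_diff:
  assumes "T \<in> bounded_ops X Y" "f \<in> ell2 X" "g \<in> ell2 X"
  shows "T (\<lambda>x. f x - g x) = (\<lambda>y. T f y - T g y)"
  using op_add[OF assms(1,2) ell2_uminus[OF assms(3)]] op_scale[OF assms(1,3), of "-1"] by simp

lemma op_sum:
  assumes T: "T \<in> bounded_ops X Y" and v: "\<And>i. i \<in> I \<Longrightarrow> v i \<in> ell2 X"
  shows "T (\<lambda>x. \<Sum>i\<in>I. c i * v i x) = (\<lambda>y. \<Sum>i\<in>I. c i * T (v i) y)"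
  using v
  by (induction I rule: infinite_finite_induct)
    (simp_all add: op_zero[OF T] op_add[OF T] op_scale[OF T] ell2_scale ell2_sum)

text \<open>
  The value of a bounded operator at \<open>f\<close> is the sum of its values on the basis, weighted with the
  coordinates of \<open>f\<close>. For a finite partial sum this is linearity. The error is the image of a tail
  of \<open>f\<close>, so boundedness and the Cauchy-Schwarz inequality make it small. Hence a bounded operator
  is determined by its matrix \<open>T (ket x) y\<close>, whose row index is \<open>y\<close>.
\<close>

lemma inner_op_has_sum:
  assumes T: "T \<in> bounded_ops X Y" and f: "f \<in> ell2 X" and g: "g \<in> ell2 Y"
  shows "((\<lambda>x. f x * ell2_inner Y (T (ket x)) g) has_sum ell2_inner Y (T f) g) X"
proof -
  obtain K where K: "K \<ge> 0" "\<And>f. f \<in> ell2 X \<Longrightarrow> ell2_norm Y (T f) \<le> K * ell2_norm X f"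
    using op_bounded[OF T] by blast
  let ?r = "\<lambda>F x. if x \<in> F then f x else 0"
  let ?t = "\<lambda>F. ell2_norm X (\<lambda>x. f x - ?r F x)"
  have part: "(\<Sum>x\<in>F. f x * ell2_inner Y (T (ket x)) g) = ell2_inner Y (T (?r F)) g"
    if "finite F" "F \<subseteq> X" for F
  proof -
    have ket: "ket i \<in> ell2 X" if "i \<in> F" for i using that \<open>F \<subseteq> X\<close> by (auto intro: ell2_ket)
    have "T (?r F) = (\<lambda>y. \<Sum>i\<in>F. f i * T (ket i) y)"
      unfolding restrict_finite_eq_sum[OF \<open>finite F\<close>] by (rule op_sum[OF T ket])
    then show ?thesis
      using ell2_inner_sum_left[where I = F and v = "\<lambda>i. T (ket i)" and c = f, OF op_in[OF T ket] g] by simp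
  qed
  have bound: "norm ((\<Sum>x\<in>F. f x * ell2_inner Y (T (ket x)) g) - ell2_inner Y (T f) g)
      \<le> K * ell2_norm Y g * ?t F" if F: "finite F" "F \<subseteq> X" for F
  proof -
    have r: "?r F \<in> ell2 X" by (rule ell2_restrict[OF f])
    have d: "(\<lambda>x. f x - ?r F x) \<in> ell2 X" by (rule ell2_diff[OF f r])
    have "norm ((\<Sum>x\<in>F. f x * ell2_inner Y (T (ket x)) g) - ell2_inner Y (T f) g)
        = cmod (ell2_inner Y (T (\<lambda>x. f x - ?r F x)) g)"
      by (simp add: part[OF F] op_diff[OF T f r] ell2_inner_diff_left op_in[OF T] f r g norm_minus_commute)
    also have "\<dots> \<le> ell2_norm Y (T (\<lambda>x. f x - ?r F x)) * ell2_norm Y g"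
      by (rule ell2_cauchy_schwarz[OF op_in[OF T d] g])
    also have "\<dots> \<le> K * ?t F * ell2_norm Y g"
      by (intro mult_right_mono K d) simp
    finally show ?thesis by (simp add: mult_ac)
  qed
  have "((\<lambda>F. K * ell2_norm Y g * ?t F) \<longlongrightarrow> K * ell2_norm Y g * 0) (finite_subsets_at_top X)"
    by (intro tendsto_intros norm_tail_tendsto f)
  then have "((\<lambda>F. (\<Sum>x\<in>F. f x * ell2_inner Y (T (ket x)) g) - ell2_inner Y (T f) g)
      \<longlongrightarrow> 0) (finite_subsets_at_top X)"
    by (intro Lim_null_comparison[OF eventually_finite_subsets_at_top_weakI[OF bound]]) simp_all
  then show ?thesis by (simp add: has_sum_def Lim_null[symmetric])
qed

lemma op_coordinate_has_sum:
  assumes "T \<in> bounded_ops X Y" "f \<in> ell2 X" "y \<in> Y"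
  shows "((\<lambda>x. f x * T (ket x) y) has_sum T f y) X"
proof -
  have "((\<lambda>x. f x * ell2_inner Y (T (ket x)) (ket y)) has_sum ell2_inner Y (T f) (ket y)) X"
    by (rule inner_op_has_sum[OF assms(1,2) ell2_ket[OF assms(3)]])
  then show ?thesis
    unfolding ell2_inner_ket[OF op_in[OF assms(1,2)] assms(3)]
    by (rule has_sum_cong[THEN iffD1, rotated]) (simp add: ell2_inner_ket op_in[OF assms(1)] ell2_ket assms(3))
qed

lemma op_coordinate_eq_0:
  assumes "T \<in> bounded_ops X Y" "f \<in> ell2 X" "y \<in> Y" "\<And>x. x \<in> X \<Longrightarrow> f x * T (ket x) y = 0"
  shows "T f y = 0"
  using has_sum_unique[OF op_coordinate_has_sum[OF assms(1-3)] has_sum_0[OF assms(4)]] .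

lemma op_eq_if_matrix_eq:
  assumes S: "S \<in> bounded_ops X Y" and T: "T \<in> bounded_ops X Y"
    and eq: "\<And>x y. x \<in> X \<Longrightarrow> y \<in> Y \<Longrightarrow> S (ket x) y = T (ket x) y"
  shows "S = T"
proof (rule op_eqI[OF S T], rule ext)
  fix f y assume f: "f \<in> ell2 X"
  show "S f y = T f y"
  proof (cases "y \<in> Y")
    case True
    have "((\<lambda>x. f x * S (ket x) y) has_sum S f y) X"
      by (rule op_coordinate_has_sum[OF S f True])
    then have "((\<lambda>x. f x * T (ket x) y) has_sum S f y) X"
      by (rule has_sum_cong[THEN iffD1, rotated]) (simp add: eq True)
    then show ?thesis using op_coordinate_has_sum[OF T f True] has_sum_unique by blast
  qed (simp add: op_in[OF S f, THEN ell2_outside] op_in[OF T f, THEN ell2_outside])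
qed

text \<open>
  \<open>adjoint_op\<close> is a definite description; it is computed by exhibiting an operator with the
  characteristic property \<open>is_adjoint\<close>, which has at most one solution.
\<close>

definition is_adjoint :: "'a set \<Rightarrow> 'b set \<Rightarrow> (('a \<Rightarrow> complex) \<Rightarrow> ('b \<Rightarrow> complex)) \<Rightarrow>
    (('b \<Rightarrow> complex) \<Rightarrow> ('a \<Rightarrow> complex)) \<Rightarrow> bool" where
  "is_adjoint X Y T S \<longleftrightarrow> S \<in> bounded_ops Y X \<and>
     (\<forall>f\<in>ell2 X. \<forall>g\<in>ell2 Y. ell2_inner Y (T f) g = ell2_inner X f (S g))"

lemma is_adjoint_unique:
  assumes "is_adjoint X Y T S" "is_adjoint X Y T S'"
  shows "S = S'"
proof (rule op_eqI)
  fix g assume g: "g \<in> ell2 Y"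
  show "S g = S' g"
    by (rule ell2_eqI[of _ X]) (use assms g in \<open>auto simp: is_adjoint_def op_in\<close>)
qed (use assms in \<open>auto simp: is_adjoint_def\<close>)

lemma adjoint_op_eqI: "is_adjoint X Y T S \<Longrightarrow> adjoint_op X Y T = S"
  unfolding adjoint_op_def is_adjoint_def[symmetric] by (rule the_equality) (auto intro: is_adjoint_unique)

text \<open>
  The adjoint is written down from its matrix: coordinate \<open>x\<close> of the image of \<open>g\<close> has to be the
  inner product of \<open>g\<close> with \<open>T (ket x)\<close>. This is the Riesz representation in coordinates. That
  the resulting function is square summable follows by duality: pairing \<open>g\<close> with the image under \<open>T\<close>
  of a finite part \<open>h\<close> of the function yields the square norm of \<open>h\<close>, which is therefore at most
  the product of the norms of \<open>h\<close> and \<open>g\<close> with a bound \<open>K\<close> for \<open>T\<close>.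
\<close>

lemma is_adjoint_adjoint_op:
  assumes T: "T \<in> bounded_ops X Y"
  shows "is_adjoint X Y T (adjoint_op X Y T)"
proof -
  define S where "S = (\<lambda>g\<in>ell2 Y. \<lambda>x. if x \<in> X then ell2_inner Y g (T (ket x)) else 0)"
  have S: "S g x = ell2_inner Y g (T (ket x))" if "g \<in> ell2 Y" "x \<in> X" for g x
    using that by (simp add: S_def)
  obtain K where K: "K \<ge> 0" "\<And>f. f \<in> ell2 X \<Longrightarrow> ell2_norm Y (T f) \<le> K * ell2_norm X f"
    using op_bounded[OF T] by blast
  have partial: "(\<Sum>x\<in>F. (cmod (S g x))\<^sup>2) \<le> (K * ell2_norm Y g)\<^sup>2"
    if g: "g \<in> ell2 Y" and F: "finite F" "F \<subseteq> X" for g F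
  proof -
    let ?s = "\<Sum>x\<in>F. (cmod (S g x))\<^sup>2"
    \<comment> \<open>\<open>h\<close> is the part of \<open>S g\<close> on \<open>F\<close>; pairing \<open>T h\<close> with \<open>g\<close> returns the square norm of \<open>h\<close>.\<close>
    define h where "h = (\<lambda>x. \<Sum>i\<in>F. S g i * ket i x)"
    have ket: "ket i \<in> ell2 X" if "i \<in> F" for i using that F by (auto intro: ell2_ket)
    have h: "h \<in> ell2 X" unfolding h_def by (rule ell2_sum[OF ket])
    have hr: "h = (\<lambda>x. if x \<in> F then S g x else 0)"
      unfolding h_def by (rule restrict_finite_eq_sum[OF F(1), symmetric])
    have nh: "(ell2_norm X h)\<^sup>2 = ?s"
      unfolding ell2_norm_square hr by (rule infsumI, rule has_sum_finite_neutralI[OF F]) auto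
    have "T h = (\<lambda>y. \<Sum>i\<in>F. S g i * T (ket i) y)"
      unfolding h_def by (rule op_sum[OF T ket])
    then have "ell2_inner Y (T h) g = (\<Sum>i\<in>F. S g i * ell2_inner Y (T (ket i)) g)"
      using ell2_inner_sum_left[where I = F and v = "\<lambda>i. T (ket i)" and c = "S g", OF op_in[OF T ket] g] by simp
    also have "\<dots> = (\<Sum>i\<in>F. S g i * cnj (S g i))"
      using F by (intro sum.cong) (auto simp: S[OF g] ell2_inner_cnj)
    also have "\<dots> = of_real ?s" by (simp only: complex_norm_square of_real_sum)
    finally have "cmod (ell2_inner Y (T h) g) = \<bar>?s\<bar>" by (simp only: norm_of_real)
    then have "?s = cmod (ell2_inner Y (T h) g)" by (simp add: sum_nonneg)
    also have "\<dots> \<le> ell2_norm Y (T h) * ell2_norm Y g" by (rule ell2_cauchy_schwarz[OF op_in[OF T h] g])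
    also have "\<dots> \<le> K * ell2_norm X h * ell2_norm Y g" by (intro mult_right_mono K h) simp
    finally have "ell2_norm X h * ell2_norm X h \<le> (K * ell2_norm Y g) * ell2_norm X h"
      using nh by (simp add: power2_eq_square mult_ac)
    then have "ell2_norm X h \<le> K * ell2_norm Y g"
      using ell2_norm_nonneg[of X h] K(1) ell2_norm_nonneg[of Y g]
      by (metis mult_nonneg_nonneg mult_right_le_imp_le order_le_less)
    then show ?thesis unfolding nh[symmetric] by (intro power_mono) auto
  qed
  have Sin: "S g \<in> ell2 X" if g: "g \<in> ell2 Y" for g
  proof (rule ell2I)
    show "(\<lambda>x. (cmod (S g x))\<^sup>2) summable_on X"
      by (rule nonneg_bdd_above_summable_on) (auto intro!: bdd_aboveI2 partial[OF g])
  qed (use g in \<open>simp add: S_def\<close>)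
  have "S \<in> bounded_ops Y X"
  proof (rule bounded_opsI[where K = K])
    show "ell2_norm X (S g) \<le> K * ell2_norm Y g" if g: "g \<in> ell2 Y" for g
    proof -
      have "(ell2_norm X (S g))\<^sup>2 \<le> (K * ell2_norm Y g)\<^sup>2"
        unfolding ell2_norm_square by (rule infsum_le_finite_sums[OF ell2_summable[OF Sin[OF g]] partial[OF g]])
      then show ?thesis by (rule power2_le_imp_le) (simp add: K)
    qed
  qed (auto simp: Sin, auto simp: S_def fun_eq_iff ell2_add ell2_scale ell2_inner_add_left ell2_inner_scale_left op_in[OF T] ell2_ket)
  moreover have "ell2_inner Y (T f) g = ell2_inner X f (S g)" if f: "f \<in> ell2 X" and g: "g \<in> ell2 Y" for f g
  proof -
    have "((\<lambda>x. f x * ell2_inner Y (T (ket x)) g) has_sum ell2_inner Y (T f) g) X"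
      by (rule inner_op_has_sum[OF T f g])
    then have "((\<lambda>x. f x * cnj (S g x)) has_sum ell2_inner Y (T f) g) X"
      by (rule has_sum_cong[THEN iffD1, rotated]) (simp add: S[OF g] ell2_inner_cnj)
    then show ?thesis using ell2_inner_has_sum[OF f Sin[OF g]] has_sum_unique by blast
  qed
  ultimately have "is_adjoint X Y T S" by (auto simp: is_adjoint_def)
  then show ?thesis using adjoint_op_eqI by metis
qed

lemma adjoint_in: "T \<in> bounded_ops X Y \<Longrightarrow> adjoint_op X Y T \<in> bounded_ops Y X"
  using is_adjoint_adjoint_op by (auto simp: is_adjoint_def)

lemma inner_adjoint:
  "T \<in> bounded_ops X Y \<Longrightarrow> f \<in> ell2 X \<Longrightarrow> g \<in> ell2 Y \<Longrightarrow>
    ell2_inner Y (T f) g = ell2_inner X f (adjoint_op X Y T g)"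
  using is_adjoint_adjoint_op by (fastforce simp: is_adjoint_def)

lemma inner_adjoint':
  assumes "T \<in> bounded_ops X Y" "f \<in> ell2 X" "g \<in> ell2 Y"
  shows "ell2_inner X (adjoint_op X Y T g) f = ell2_inner Y g (T f)"
  using arg_cong[OF inner_adjoint[OF assms], of cnj] by (simp add: ell2_inner_cnj)

lemma adjoint_matrix:
  assumes "T \<in> bounded_ops X Y" "x \<in> X" "y \<in> Y"
  shows "adjoint_op X Y T (ket y) x = cnj (T (ket x) y)"
  using inner_adjoint'[OF assms(1) ell2_ket[OF assms(2)] ell2_ket[OF assms(3)]]
    ell2_inner_ket[OF op_in[OF adjoint_in[OF assms(1)] ell2_ket[OF assms(3)]] assms(2)]
    arg_cong[OF ell2_inner_ket[OF op_in[OF assms(1) ell2_ket[OF assms(2)]] assms(3)], of cnj]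
  by (simp add: ell2_inner_cnj)

lemma adjoint_adjoint:
  assumes "T \<in> bounded_ops X Y"
  shows "adjoint_op Y X (adjoint_op X Y T) = T"
  by (rule adjoint_op_eqI) (simp add: is_adjoint_def assms inner_adjoint')

lemma mult_op_apply: "f \<in> ell2 X \<Longrightarrow> mult_op X S T f = S (T f)"
  by (simp add: mult_op_def compose_eq)

lemma mult_op_bounded:
  assumes S: "S \<in> bounded_ops Y Z" and T: "T \<in> bounded_ops X Y"
  shows "mult_op X S T \<in> bounded_ops X Z"
proof -
  obtain K where K: "K \<ge> 0" "\<And>f. f \<in> ell2 Y \<Longrightarrow> ell2_norm Z (S f) \<le> K * ell2_norm Y f"
    using op_bounded[OF S] by blast
  obtain L where L: "L \<ge> 0" "\<And>f. f \<in> ell2 X \<Longrightarrow> ell2_norm Y (T f) \<le> L * ell2_norm X f"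
    using op_bounded[OF T] by blast
  show ?thesis
  proof (rule bounded_opsI[where K = "K * L"])
    show "ell2_norm Z (mult_op X S T f) \<le> K * L * ell2_norm X f" if f: "f \<in> ell2 X" for f
      using K(2)[OF op_in[OF T f]] mult_left_mono[OF L(2)[OF f] K(1)]
      by (simp add: mult_op_apply f mult.assoc)
  qed (auto simp: mult_op_apply ell2_add ell2_scale op_add[OF T] op_scale[OF T]
      op_add[OF S] op_scale[OF S] op_in[OF T] op_in[OF S], simp add: mult_op_def compose_def)
qed

lemma add_op_bounded:
  assumes S: "S \<in> bounded_ops X Y" and T: "T \<in> bounded_ops X Y"
  shows "add_op X S T \<in> bounded_ops X Y"
proof -
  obtain K where K: "K \<ge> 0" "\<And>f. f \<in> ell2 X \<Longrightarrow> ell2_norm Y (S f) \<le> K * ell2_norm X f"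
    using op_bounded[OF S] by blast
  obtain L where L: "L \<ge> 0" "\<And>f. f \<in> ell2 X \<Longrightarrow> ell2_norm Y (T f) \<le> L * ell2_norm X f"
    using op_bounded[OF T] by blast
  show ?thesis
  proof (rule bounded_opsI[where K = "K + L"])
    show "ell2_norm Y (add_op X S T f) \<le> (K + L) * ell2_norm X f" if f: "f \<in> ell2 X" for f
      using ell2_norm_triangle[OF op_in[OF S f] op_in[OF T f]] K(2)[OF f] L(2)[OF f]
      by (simp add: add_op_def f distrib_right)
  qed (auto simp: add_op_def ell2_add ell2_scale op_add[OF T] op_scale[OF T]
      op_add[OF S] op_scale[OF S] op_in[OF T] op_in[OF S] fun_eq_iff algebra_simps)
qed

lemma scale_op_bounded:
  assumes T: "T \<in> bounded_ops X Y"
  shows "scale_op X c T \<in> bounded_ops X Y"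
proof -
  obtain L where L: "L \<ge> 0" "\<And>f. f \<in> ell2 X \<Longrightarrow> ell2_norm Y (T f) \<le> L * ell2_norm X f"
    using op_bounded[OF T] by blast
  show ?thesis
  proof (rule bounded_opsI[where K = "cmod c * L"])
    show "ell2_norm Y (scale_op X c T f) \<le> cmod c * L * ell2_norm X f" if f: "f \<in> ell2 X" for f
      using mult_left_mono[OF L(2)[OF f] norm_ge_zero[of c]]
      by (simp add: scale_op_def f ell2_norm_scale mult.assoc)
  qed (auto simp: scale_op_def ell2_add ell2_scale op_add[OF T] op_scale[OF T] op_in[OF T]
      fun_eq_iff algebra_simps)
qed

lemma zero_op_bounded: "zero_op X \<in> bounded_ops X Y"
  by (rule bounded_opsI[where K = 0]) (auto simp: zero_op_def ell2_add ell2_scale)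

text \<open>
  In bra-ket notation, \<open>rank_one X v w\<close> is $|v\rangle\langle w|$.
\<close>

definition rank_one :: "'a set \<Rightarrow> ('b \<Rightarrow> complex) \<Rightarrow> ('a \<Rightarrow> complex) \<Rightarrow> ('a \<Rightarrow> complex) \<Rightarrow> ('b \<Rightarrow> complex)" where
  "rank_one X v w = (\<lambda>f\<in>ell2 X. \<lambda>y. ell2_inner X f w * v y)"

lemma rank_one_apply: "f \<in> ell2 X \<Longrightarrow> rank_one X v w f = (\<lambda>y. ell2_inner X f w * v y)"
  by (simp add: rank_one_def)

lemma rank_one_bounded:
  assumes v: "v \<in> ell2 Y" and w: "w \<in> ell2 X"
  shows "rank_one X v w \<in> bounded_ops X Y"
proof (rule bounded_opsI[where K = "ell2_norm X w * ell2_norm Y v"])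
  show "ell2_norm Y (rank_one X v w f) \<le> ell2_norm X w * ell2_norm Y v * ell2_norm X f"
    if f: "f \<in> ell2 X" for f
    using mult_right_mono[OF ell2_cauchy_schwarz[OF f w] ell2_norm_nonneg[of Y v]]
    by (simp add: rank_one_apply f ell2_norm_scale mult.assoc mult.left_commute mult.commute[of "ell2_norm X f"])
qed (auto simp: rank_one_def ell2_add ell2_scale v w ell2_inner_add_left ell2_inner_scale_left
    fun_eq_iff distrib_right mult.assoc)

lemma adjoint_rank_one:
  assumes v: "v \<in> ell2 Y" and w: "w \<in> ell2 X"
  shows "adjoint_op X Y (rank_one X v w) = rank_one Y w v"
  by (rule adjoint_op_eqI)
    (auto simp: is_adjoint_def rank_one_bounded v w rank_one_apply ell2_inner_scale_left
      ell2_inner_scale_right ell2_inner_cnj)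

lemma mult_rank_one:
  assumes "T \<in> bounded_ops Y Z" "v \<in> ell2 Y" "w \<in> ell2 X"
  shows "mult_op X T (rank_one X v w) = rank_one X (T v) w"
  by (rule op_eqI[OF mult_op_bounded[OF assms(1) rank_one_bounded[OF assms(2,3)]]
        rank_one_bounded[OF op_in[OF assms(1,2)] assms(3)]])
    (simp add: mult_op_apply rank_one_apply op_scale[OF assms(1,2)])

lemma mult_rank_one_rank_one:
  assumes "v' \<in> ell2 Y"
  shows "mult_op X (rank_one Y v w) (rank_one X v' w') = rank_one X (\<lambda>y. ell2_inner Y v' w * v y) w'"
  by (auto simp: mult_op_def compose_def rank_one_def ell2_scale[OF assms] ell2_inner_scale_left fun_eq_iff)

section \<open>Operators supported on an equivalence relation\<close>

text \<open>
  Membership in $\mathbb{M}(\Omega)$ is a condition on single matrix entries. One direction takes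
  singletons for the two sets \<open>E\<close> and \<open>F\<close>; in the other, a bounded operator is determined by its
  matrix, so vanishing entries on \<open>E \<times> F\<close> make the whole corner vanish.
\<close>

lemma supp_ops_iff_matrix:
  "T \<in> supp_ops X \<Omega> \<longleftrightarrow>
    T \<in> bounded_ops X X \<and> (\<forall>x\<in>X. \<forall>y\<in>X. (x, y) \<notin> \<Omega> \<longrightarrow> T (ket x) y = 0)"
    (is "?L \<longleftrightarrow> ?R")
proof
  assume L: ?L
  then have T: "T \<in> bounded_ops X X" by (simp add: supp_ops_def)
  have "T (ket x) y = 0" if xy: "x \<in> X" "y \<in> X" "(x, y) \<notin> \<Omega>" for x y
  proof -
    have "mult_op X (proj_op X {y}) (mult_op X T (proj_op X {x})) = zero_op X"
      using L xy by (auto simp: supp_ops_def)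
    moreover have "proj_op X {x} (ket x) = ket x"
      using xy by (simp add: proj_op_def ell2_ket) (simp add: ket_def fun_eq_iff indicator_def)
    ultimately have "proj_op X {y} (T (ket x)) = zero_op X (ket x)"
      using xy by (metis mult_op_apply ell2_ket)
    from fun_cong[OF this, of y] show ?thesis
      using xy by (simp add: proj_op_def zero_op_def op_in[OF T] ell2_ket)
  qed
  with T show ?R by blast
next
  assume R: ?R
  then have T: "T \<in> bounded_ops X X" by blast
  have "mult_op X (proj_op X F) (mult_op X T (proj_op X E)) = zero_op X"
    if EF: "E \<subseteq> X" "F \<subseteq> X" "E \<times> F \<subseteq> X \<times> X - \<Omega>" for E F
  proof
    fix f show "mult_op X (proj_op X F) (mult_op X T (proj_op X E)) f = zero_op X f"
    proof (cases "f \<in> ell2 X")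
      case f: True
      have "proj_op X E f = (\<lambda>x. if x \<in> E then f x else 0)" using f by (auto simp: proj_op_def)
      then have pf: "proj_op X E f \<in> ell2 X" using ell2_restrict[OF f] by simp
      have "T (proj_op X E f) y = 0" if y: "y \<in> F" for y
      proof (rule op_coordinate_eq_0[OF T pf])
        show "y \<in> X" using y EF by blast
        show "proj_op X E f x * T (ket x) y = 0" if "x \<in> X" for x
          using R y EF that f by (cases "x \<in> E") (auto simp: proj_op_def)
      qed
      then show ?thesis
        using f pf op_in[OF T pf]
        by (auto simp: mult_op_apply proj_op_def[of X F] zero_op_def indicator_def)
    qed (simp add: mult_op_def compose_def zero_op_def)
  qed
  with T show ?L by (auto simp: supp_ops_def)
qed

lemma supp_ops_bounded: "T \<in> supp_ops X \<Omega> \<Longrightarrow> T \<in> bounded_ops X X"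
  by (simp add: supp_ops_def)

lemma supp_ops_matrix: "T \<in> supp_ops X \<Omega> \<Longrightarrow> x \<in> X \<Longrightarrow> y \<in> X \<Longrightarrow> (x, y) \<notin> \<Omega> \<Longrightarrow> T (ket x) y = 0"
  by (simp add: supp_ops_iff_matrix)

lemma rel_iff_in_class:
  assumes "equiv X R" "C \<in> X // R" "x \<in> C"
  shows "(x, y) \<in> R \<longleftrightarrow> y \<in> C"
  using assms by (meson in_quotient_imp_closed in_quotient_imp_in_rel empty_subsetI insert_subset)

lemma class_subset:
  assumes "equiv X R" "C \<in> X // R" shows "C \<subseteq> X"
  by (rule in_quotient_imp_subset[OF assms])

text \<open>
  For an equivalence relation the matrix is block diagonal, so vectors supported in one class are
  mapped to vectors supported in the same class. In other words, $\mathbb{M}(R)$ is the direct sum of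
  the algebras of all bounded operators on $\ell^2(C)$, where $C$ runs through the classes.
\<close>

lemma supp_ops_preserves_class:
  assumes R: "equiv X R" and T: "T \<in> supp_ops X R" and f: "f \<in> ell2 X"
    and C: "C \<in> X // R" "\<And>x. x \<notin> C \<Longrightarrow> f x = 0" and y: "y \<notin> C"
  shows "T f y = 0"
proof (cases "y \<in> X")
  case True
  have "f x * T (ket x) y = 0" if "x \<in> X" for x
    using supp_ops_matrix[OF T that True] C(2)[of x] rel_iff_in_class[OF R C(1), of x y] y by auto
  then show ?thesis by (rule op_coordinate_eq_0[OF supp_ops_bounded[OF T] f True])
qed (simp add: ell2_outside[OF op_in[OF supp_ops_bounded[OF T] f]])

lemma zero_in_supp_ops: "zero_op X \<in> supp_ops X \<Omega>"
  by (simp add: supp_ops_iff_matrix zero_op_bounded) (simp add: zero_op_def ell2_ket)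

lemma add_in_supp_ops: "S \<in> supp_ops X \<Omega> \<Longrightarrow> T \<in> supp_ops X \<Omega> \<Longrightarrow> add_op X S T \<in> supp_ops X \<Omega>"
  by (simp add: supp_ops_iff_matrix add_op_bounded) (simp add: add_op_def ell2_ket)

lemma scale_in_supp_ops: "T \<in> supp_ops X \<Omega> \<Longrightarrow> scale_op X c T \<in> supp_ops X \<Omega>"
  by (simp add: supp_ops_iff_matrix scale_op_bounded) (simp add: scale_op_def ell2_ket)

lemma mult_in_supp_ops:
  assumes R: "equiv X R" and S: "S \<in> supp_ops X R" and T: "T \<in> supp_ops X R"
  shows "mult_op X S T \<in> supp_ops X R"
  unfolding supp_ops_iff_matrix
proof (intro conjI ballI impI)
  show "mult_op X S T \<in> bounded_ops X X" by (rule mult_op_bounded[OF supp_ops_bounded[OF S] supp_ops_bounded[OF T]])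
  fix x y assume xy: "x \<in> X" "y \<in> X" "(x, y) \<notin> R"
  let ?C = "R `` {x}"
  have C: "?C \<in> X // R" using xy by (auto intro: quotientI)
  have "x \<in> ?C" by (rule equiv_class_self[OF R xy(1)])
  then have "T (ket x) z = 0" if "z \<notin> ?C" for z
    using supp_ops_preserves_class[OF R T ell2_ket[OF xy(1)] C _ that] by (auto simp: ket_def)
  then show "mult_op X S T (ket x) y = 0"
    using supp_ops_preserves_class[OF R S op_in[OF supp_ops_bounded[OF T] ell2_ket[OF xy(1)]] C, of y] xy
    by (simp add: mult_op_apply ell2_ket)
qed

lemma adjoint_in_supp_ops:
  assumes R: "equiv X R" and T: "T \<in> supp_ops X R"
  shows "adjoint_op X X T \<in> supp_ops X R"
  unfolding supp_ops_iff_matrix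
proof (intro conjI ballI impI)
  show "adjoint_op X X T \<in> bounded_ops X X" by (rule adjoint_in[OF supp_ops_bounded[OF T]])
  fix x y assume xy: "x \<in> X" "y \<in> X" "(x, y) \<notin> R"
  then have "(y, x) \<notin> R" using R by (meson equivE symD)
  then show "adjoint_op X X T (ket x) y = 0"
    using xy by (simp add: adjoint_matrix[OF supp_ops_bounded[OF T]] supp_ops_matrix[OF T])
qed

text \<open>
  These operators supply the matrix units within a block, and the elements on which the minimality of
  a projection is tested.
\<close>

lemma rank_one_in_supp_ops:
  assumes R: "equiv X R" and C: "C \<in> X // R"
    and v: "v \<in> ell2 X" "\<And>x. x \<notin> C \<Longrightarrow> v x = 0" and w: "w \<in> ell2 X" "\<And>x. x \<notin> C \<Longrightarrow> w x = 0"
  shows "rank_one X v w \<in> supp_ops X R"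
  unfolding supp_ops_iff_matrix
proof (intro conjI ballI impI)
  show "rank_one X v w \<in> bounded_ops X X" by (rule rank_one_bounded[OF v(1) w(1)])
  fix x y assume xy: "x \<in> X" "y \<in> X" "(x, y) \<notin> R"
  have "ell2_inner X (ket x) w = cnj (w x)"
    using arg_cong[OF ell2_inner_ket[OF w(1) xy(1)], of cnj] by (simp add: ell2_inner_cnj)
  moreover have "w x = 0 \<or> v y = 0"
    using v(2) w(2) rel_iff_in_class[OF R C, of x y] xy(3) by blast
  ultimately show "rank_one X v w (ket x) y = 0" using xy by (auto simp: rank_one_apply ell2_ket)
qed

text \<open>
  The inverse of a star-isomorphism respects the operations because sums, multiples, products and
  adjoints of elements of $\mathbb{M}(R)$ belong to $\mathbb{M}(R)$ again. By this symmetry, an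
  inequality between cardinals in one direction is enough.
\<close>

lemma star_isomorphic_sym:
  assumes R: "equiv X R" and iso: "star_isomorphic X Y (supp_ops X R) \<B>"
  shows "star_isomorphic Y X \<B> (supp_ops X R)"
proof -
  let ?A = "supp_ops X R"
  obtain \<phi> where bij: "bij_betw \<phi> ?A \<B>"
    and hom: "\<And>S T. S \<in> ?A \<Longrightarrow> T \<in> ?A \<Longrightarrow> \<phi> (add_op X S T) = add_op Y (\<phi> S) (\<phi> T)"
      "\<And>c T. T \<in> ?A \<Longrightarrow> \<phi> (scale_op X c T) = scale_op Y c (\<phi> T)"
      "\<And>S T. S \<in> ?A \<Longrightarrow> T \<in> ?A \<Longrightarrow> \<phi> (mult_op X S T) = mult_op Y (\<phi> S) (\<phi> T)"
      "\<And>T. T \<in> ?A \<Longrightarrow> \<phi> (adjoint_op X X T) = adjoint_op Y Y (\<phi> T)"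
    using iso unfolding star_isomorphic_def by blast
  let ?\<psi> = "inv_into ?A \<phi>"
  have in_A: "?\<psi> T \<in> ?A" and inv: "\<phi> (?\<psi> T) = T" if "T \<in> \<B>" for T
    using bij that by (auto simp: bij_betw_def inv_into_into f_inv_into_f)
  have inv': "?\<psi> T' = T" if "T \<in> ?A" "\<phi> T = T'" for T T'
    using bij that by (auto simp: bij_betw_def)
  show ?thesis
    unfolding star_isomorphic_def
    by (intro exI[of _ ?\<psi>] conjI ballI allI bij_betw_inv_into[OF bij] inv')
      (simp_all add: in_A inv hom add_in_supp_ops scale_in_supp_ops mult_in_supp_ops[OF R] adjoint_in_supp_ops[OF R])
qed

text \<open>
  A minimal projection \<open>p\<close> lives in a single block and has rank one there. Pick a basis vector that
  \<open>p\<close> does not kill, and normalise its image to \<open>\<xi>\<close>. Since \<open>p\<close> preserves classes, \<open>\<xi>\<close> is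
  supported in one class, so the projection to the line of \<open>\<xi>\<close> belongs to the algebra. Because \<open>p\<close>
  is self-adjoint and fixes \<open>\<xi>\<close>, compressing that projection by \<open>p\<close> does not change it; by
  minimality it is a multiple of \<open>p\<close>, and evaluation at \<open>\<xi>\<close> shows that the factor is \<open>1\<close>.
\<close>

lemma minimal_projection_rank_one:
  assumes S: "equiv Y S" and p: "p \<in> supp_ops Y S" "p \<noteq> zero_op Y"
    and idem: "mult_op Y p p = p" and self: "adjoint_op Y Y p = p"
    and minimal: "\<And>T. T \<in> supp_ops Y S \<Longrightarrow> \<exists>c. mult_op Y p (mult_op Y T p) = scale_op Y c p"
  obtains D \<xi> where "D \<in> Y // S" "\<xi> \<in> ell2 Y" "\<And>y. y \<notin> D \<Longrightarrow> \<xi> y = 0" "ell2_norm Y \<xi> = 1"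
    "p = rank_one Y \<xi> \<xi>"
proof -
  note pb = supp_ops_bounded[OF p(1)]
  obtain y where y: "y \<in> Y" "p (ket y) \<noteq> (\<lambda>_. 0)"
  proof (rule ccontr)
    assume "\<not> thesis"
    then have "p (ket x) = (\<lambda>_. 0)" if "x \<in> Y" for x using that \<open>\<And>y. y \<in> Y \<Longrightarrow> _ \<Longrightarrow> thesis\<close> by blast
    then have "p = zero_op Y"
      by (intro op_eq_if_matrix_eq[OF pb zero_op_bounded]) (simp add: zero_op_def ell2_ket)
    then show False using p(2) by simp
  qed
  define v where "v = p (ket y)"
  define n where "n = ell2_norm Y v"
  define \<xi> where "\<xi> = (\<lambda>z. of_real (1 / n) * v z)"
  let ?D = "S `` {y}"
  have D: "?D \<in> Y // S" using y by (auto intro: quotientI)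
  have v: "v \<in> ell2 Y" unfolding v_def by (rule op_in[OF pb ell2_ket[OF y(1)]])
  have n: "n > 0" using ell2_norm_eq_0[OF v] y(2) ell2_norm_nonneg[of Y v] unfolding n_def v_def by (metis order_le_less)
  have \<xi>: "\<xi> \<in> ell2 Y" unfolding \<xi>_def by (rule ell2_scale[OF v])
  have norm: "ell2_norm Y \<xi> = 1" unfolding \<xi>_def ell2_norm_scale using n by (simp add: n_def norm_divide)
  have pv: "p v = v" unfolding v_def using fun_cong[OF idem, of "ket y"] y by (simp add: mult_op_apply ell2_ket)
  have p\<xi>: "p \<xi> = \<xi>" unfolding \<xi>_def op_scale[OF pb v] pv by simp
  have supp: "\<xi> z = 0" if "z \<notin> ?D" for z
    using supp_ops_preserves_class[OF S p(1) ell2_ket[OF y(1)] D _ that] equiv_class_self[OF S y(1)]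
    by (auto simp: \<xi>_def v_def ket_def)
  have R1: "rank_one Y \<xi> \<xi> \<in> supp_ops Y S" by (rule rank_one_in_supp_ops[OF S D \<xi> supp \<xi> supp])
  then obtain c where c: "mult_op Y p (mult_op Y (rank_one Y \<xi> \<xi>) p) = scale_op Y c p"
    using minimal by blast
  have cp: "ell2_inner Y f \<xi> * \<xi> z = c * p f z" if f: "f \<in> ell2 Y" for f z
  proof -
    have pf: "p f \<in> ell2 Y" by (rule op_in[OF pb f])
    have "mult_op Y p (mult_op Y (rank_one Y \<xi> \<xi>) p) f z = ell2_inner Y (p f) \<xi> * \<xi> z"
      by (simp add: mult_op_apply f pf rank_one_apply op_scale[OF pb \<xi>] p\<xi>)
    also have "ell2_inner Y (p f) \<xi> = ell2_inner Y f \<xi>"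
      using inner_adjoint[OF pb f \<xi>] by (simp add: self p\<xi>)
    finally show ?thesis by (simp add: c scale_op_def f)
  qed
  obtain z where z: "\<xi> z \<noteq> 0" using norm ell2_norm_zero[of Y] by (metis ext zero_neq_one)
  have "c = 1" using cp[OF \<xi>, of z] z by (simp add: p\<xi> ell2_inner_self[OF \<xi>] norm)
  then have "p = rank_one Y \<xi> \<xi>"
    by (intro op_eqI[OF pb rank_one_bounded[OF \<xi> \<xi>]] ext) (simp add: rank_one_apply cp)
  with that D \<xi> supp norm show ?thesis by blast
qed

section \<open>What a star-isomorphism remembers\<close>

text \<open>
  The coordinate projections \<open>E x x\<close> are pairwise orthogonal minimal projections, a property which
  refers to the star-algebra structure alone. Their images are therefore projections to the lines of
  orthonormal vectors \<open>\<xi> x\<close>, each supported in a class \<open>D x\<close>. Whether \<open>x\<close> and \<open>x'\<close> are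
  equivalent is algebraic too: it means that the corner $e_{x'}\,\mathbb{M}(R)\,e_x$ is nonzero. On the
  other side the corresponding corner is nonzero precisely if \<open>D x = D x'\<close>. Hence \<open>D\<close> separates
  the classes.
\<close>

lemma star_isomorphism_class_map:
  fixes X :: "'a set" and Y :: "'b set"
  assumes R: "equiv X R" and S: "equiv Y S"
    and iso: "star_isomorphic X Y (supp_ops X R) (supp_ops Y S)"
  obtains D \<xi> where "\<forall>x\<in>X. D x \<in> Y // S"
    and "\<forall>x\<in>X. \<xi> x \<in> ell2 Y \<and> (\<forall>y. y \<notin> D x \<longrightarrow> \<xi> x y = 0)"
    and "\<forall>x\<in>X. \<forall>x'\<in>X. ell2_inner Y (\<xi> x) (\<xi> x') = of_bool (x = x')"
    and "\<forall>x\<in>X. \<forall>x'\<in>X. D x = D x' \<longleftrightarrow> (x, x') \<in> R"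
proof -
  let ?A = "supp_ops X R" and ?B = "supp_ops Y S"
  obtain \<phi> where bij: "bij_betw \<phi> ?A ?B"
    and scale: "\<And>c T. T \<in> ?A \<Longrightarrow> \<phi> (scale_op X c T) = scale_op Y c (\<phi> T)"
    and mult: "\<And>S T. S \<in> ?A \<Longrightarrow> T \<in> ?A \<Longrightarrow> \<phi> (mult_op X S T) = mult_op Y (\<phi> S) (\<phi> T)"
    and adj: "\<And>T. T \<in> ?A \<Longrightarrow> \<phi> (adjoint_op X X T) = adjoint_op Y Y (\<phi> T)"
    using iso unfolding star_isomorphic_def by blast
  have zeroA: "zero_op X \<in> ?A" by (rule zero_in_supp_ops)
  have "zero_op X = scale_op X 0 (zero_op X)" by (simp add: scale_op_def zero_op_def)
  then have "\<phi> (zero_op X) = scale_op Y 0 (\<phi> (zero_op X))" using scale[OF zeroA] by metis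
  then have zero: "\<phi> (zero_op X) = zero_op Y" by (simp add: scale_op_def zero_op_def)
  have nonzero: "\<phi> T \<noteq> zero_op Y" if "T \<in> ?A" "T \<noteq> zero_op X" for T
    using bij that zeroA zero by (metis bij_betw_def inj_onD)
  have in_B: "\<phi> T \<in> ?B" if "T \<in> ?A" for T using bij that by (auto simp: bij_betw_def)
  have surj: "\<exists>T\<in>?A. \<phi> T = T'" if "T' \<in> ?B" for T'
    using bij that by (metis bij_betw_def imageE)

  \<comment> \<open>\<open>E x x'\<close> is the matrix unit that maps \<open>ket x\<close> to \<open>ket x'\<close>.\<close>
  define E where "E = (\<lambda>x x' :: 'a. rank_one X (ket x') (ket x))"
  have ket_inner: "ell2_inner X (ket x) (ket x') = of_bool (x = x')" if "x \<in> X" "x' \<in> X" for x x'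
    using that by (simp add: ell2_inner_ket ell2_ket) (auto simp: ket_def)
  have EA: "E x x' \<in> ?A" if "(x, x') \<in> R" for x x'
  proof -
    have x: "x \<in> X" "x' \<in> X" using that R by (auto simp: equiv_def refl_on_def)
    have "R `` {x} \<in> X // R" "x \<in> R `` {x}" "x' \<in> R `` {x}"
      using x that equiv_class_self[OF R x(1)] by (auto intro: quotientI)
    then show ?thesis
      unfolding E_def using x by (intro rank_one_in_supp_ops[OF R]) (auto simp: ell2_ket, auto simp: ket_def)
  qed
  have refl: "(x, x) \<in> R" if "x \<in> X" for x using R that by (simp add: equiv_def refl_on_def)
  have compress: "mult_op X (E x' x') (mult_op X T (E x x)) = scale_op X (T (ket x) x') (E x x')"
    if T: "T \<in> ?A" and x: "x \<in> X" "x' \<in> X" for T x x'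
  proof -
    note Tb = supp_ops_bounded[OF T]
    have Tx: "T (ket x) \<in> ell2 X" by (rule op_in[OF Tb ell2_ket[OF x(1)]])
    have "mult_op X T (E x x) = rank_one X (T (ket x)) (ket x)"
      unfolding E_def by (rule mult_rank_one[OF Tb]) (simp_all add: ell2_ket x)
    then have "mult_op X (E x' x') (mult_op X T (E x x))
        = rank_one X (\<lambda>y. T (ket x) x' * ket x' y) (ket x)"
      unfolding E_def
      by (simp add: mult_rank_one_rank_one Tx ell2_inner_ket[OF Tx x(2)])
    also have "\<dots> = scale_op X (T (ket x) x') (E x x')"
      by (auto simp: rank_one_def scale_op_def E_def fun_eq_iff)
    finally show ?thesis .
  qed
  have E_nonzero: "E x x' \<noteq> zero_op X" if x: "x \<in> X" "x' \<in> X" for x x'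
  proof -
    have "E x x' (ket x) x' = 1"
      using x by (simp add: E_def rank_one_apply ell2_ket ket_inner) (simp add: ket_def)
    then show ?thesis using x by (auto simp: zero_op_def ell2_ket)
  qed
  have scale1: "scale_op X 1 (E x x') = E x x'" for x x'
    by (auto simp: scale_op_def E_def rank_one_def)
  have "\<exists>D \<xi>. D \<in> Y // S \<and> \<xi> \<in> ell2 Y \<and> (\<forall>y. y \<notin> D \<longrightarrow> \<xi> y = 0) \<and> ell2_norm Y \<xi> = 1 \<and>
      \<phi> (E x x) = rank_one Y \<xi> \<xi>" if x: "x \<in> X" for x
  proof -
    note A = EA[OF refl[OF x]]
    have EE: "mult_op X (E x x) (E x x) = E x x"
      unfolding E_def using x by (simp add: mult_rank_one_rank_one ell2_ket ket_inner)
    have Eadj: "adjoint_op X X (E x x) = E x x"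
      unfolding E_def using x by (simp add: adjoint_rank_one ell2_ket)
    have min: "\<exists>c. mult_op Y (\<phi> (E x x)) (mult_op Y T (\<phi> (E x x))) = scale_op Y c (\<phi> (E x x))"
      if "T \<in> ?B" for T
    proof -
      obtain T' where T': "T' \<in> ?A" "\<phi> T' = T"
        using surj[OF \<open>T \<in> ?B\<close>] by blast
      have "mult_op Y (\<phi> (E x x)) (mult_op Y T (\<phi> (E x x)))
          = \<phi> (mult_op X (E x x) (mult_op X T' (E x x)))"
        using T' A by (simp add: mult mult_in_supp_ops[OF R])
      also have "\<dots> = scale_op Y (T' (ket x) x) (\<phi> (E x x))"
        using compress[OF T'(1) x x] scale[OF A] by simp
      finally show ?thesis by blast
    qed
    show ?thesis
      by (rule minimal_projection_rank_one[OF S in_B[OF A] nonzero[OF A E_nonzero[OF x x]] _ _ min])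
        (use mult[OF A A] adj[OF A] EE Eadj in auto)
  qed
  then obtain D \<xi> where D: "\<And>x. x \<in> X \<Longrightarrow> D x \<in> Y // S"
    and \<xi>: "\<And>x. x \<in> X \<Longrightarrow> \<xi> x \<in> ell2 Y"
    and supp: "\<And>x y. x \<in> X \<Longrightarrow> y \<notin> D x \<Longrightarrow> \<xi> x y = 0"
    and norm: "\<And>x. x \<in> X \<Longrightarrow> ell2_norm Y (\<xi> x) = 1"
    and p: "\<And>x. x \<in> X \<Longrightarrow> \<phi> (E x x) = rank_one Y (\<xi> x) (\<xi> x)"
    by metis
  have nz: "\<exists>y. \<xi> x y \<noteq> 0" if "x \<in> X" for x
    using norm[OF that] ell2_norm_zero[of Y] by (metis ext zero_neq_one)

  have compress': "mult_op Y (\<phi> (E x' x')) (mult_op Y T (\<phi> (E x x)))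
      = rank_one Y (\<lambda>y. ell2_inner Y (T (\<xi> x)) (\<xi> x') * \<xi> x' y) (\<xi> x)"
    if "T \<in> ?B" and x: "x \<in> X" "x' \<in> X" for T x x'
    using mult_rank_one[OF supp_ops_bounded[OF that(1)] \<xi>[OF x(1)] \<xi>[OF x(1)]]
      mult_rank_one_rank_one[OF op_in[OF supp_ops_bounded[OF that(1)] \<xi>[OF x(1)]]]
    by (simp add: p x)
  \<comment> \<open>The image of the corner that belongs to \<open>x\<close> and \<open>x'\<close>, computed once on either side.\<close>
  have transfer: "\<phi> (scale_op X (T (ket x) x') (E x x'))
      = rank_one Y (\<lambda>y. ell2_inner Y (\<phi> T (\<xi> x)) (\<xi> x') * \<xi> x' y) (\<xi> x)"
    if T: "T \<in> ?A" and x: "x \<in> X" "x' \<in> X" for T x x'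
    unfolding compress[OF T x, symmetric] compress'[OF in_B[OF T] x, symmetric]
    using T x by (simp add: mult mult_in_supp_ops[OF R] EA refl)

  have same_class: "D x = D x'" if xR: "(x, x') \<in> R" for x x'
  proof (rule ccontr)
    assume ne: "D x \<noteq> D x'"
    have x: "x \<in> X" "x' \<in> X" using xR R by (auto simp: equiv_def refl_on_def)
    \<comment> \<open>The image of the matrix unit maps \<open>\<xi> x\<close> to a vector supported in \<open>D x\<close>, where \<open>\<xi> x'\<close> vanishes.\<close>
    note A = EA[OF xR]
    have disj: "D x \<inter> D x' = {}" using quotient_disj[OF S D[OF x(1)] D[OF x(2)]] ne by blast
    have "\<phi> (E x x') (\<xi> x) y = 0" if "y \<notin> D x" for y
      by (rule supp_ops_preserves_class[OF S in_B[OF A] \<xi>[OF x(1)] D[OF x(1)] supp[OF x(1)] that])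
    then have "\<phi> (E x x') (\<xi> x) y * cnj (\<xi> x' y) = 0" for y
      using supp[OF x(2), of y] disj by (cases "y \<in> D x") auto
    then have "ell2_inner Y (\<phi> (E x x') (\<xi> x)) (\<xi> x') = 0"
      unfolding ell2_inner_def by (rule infsum_0)
    then have "rank_one Y (\<lambda>y. ell2_inner Y (\<phi> (E x x') (\<xi> x)) (\<xi> x') * \<xi> x' y) (\<xi> x) = zero_op Y"
      by (simp add: rank_one_def zero_op_def)
    moreover have "E x x' (ket x) x' = 1"
      using x by (simp add: E_def rank_one_apply ell2_ket ket_inner) (simp add: ket_def)
    ultimately have "\<phi> (E x x') = zero_op Y" using transfer[OF A x] by (simp add: scale1)
    then show False using nonzero[OF A E_nonzero[OF x]] by blast
  qed
  have diff_class: "(x, x') \<in> R" if x: "x \<in> X" "x' \<in> X" and eq: "D x = D x'" for x x'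
  proof (rule ccontr)
    assume nR: "(x, x') \<notin> R"
    \<comment> \<open>This operator spans the corner on the side of \<open>Y\<close>, and the corner of its preimage is zero.\<close>
    have "rank_one Y (\<xi> x') (\<xi> x) \<in> ?B"
      by (rule rank_one_in_supp_ops[OF S D[OF x(1)]]) (use \<xi> supp x eq in auto)
    then obtain T where T: "T \<in> ?A" "\<phi> T = rank_one Y (\<xi> x') (\<xi> x)" using surj by blast
    have "scale_op X (T (ket x) x') (E x x') = zero_op X"
      using supp_ops_matrix[OF T(1) x nR] by (simp add: scale_op_def zero_op_def)
    then have "rank_one Y (\<lambda>y. ell2_inner Y (\<phi> T (\<xi> x)) (\<xi> x') * \<xi> x' y) (\<xi> x) (\<xi> x) = zero_op Y (\<xi> x)"
      using transfer[OF T(1) x] zero by simp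
    then have "\<xi> x' y = 0" for y
      using x by (simp add: T(2) rank_one_apply \<xi> ell2_inner_self norm ell2_inner_scale_left zero_op_def fun_eq_iff)
    then show False using nz[OF x(2)] by blast
  qed
  have orth: "ell2_inner Y (\<xi> x) (\<xi> x') = of_bool (x = x')" if x: "x \<in> X" "x' \<in> X" for x x'
  proof (cases "x = x'")
    case False
    have "mult_op X (E x' x') (E x x) = zero_op X"
      using x False by (simp add: E_def mult_rank_one_rank_one ell2_ket ket_inner)
        (simp add: rank_one_def zero_op_def)
    then have "zero_op Y = mult_op Y (\<phi> (E x' x')) (\<phi> (E x x))"
      using mult[OF EA EA, OF refl refl, OF x(2,1)] zero by simp
    also have "\<dots> = rank_one Y (\<lambda>y. ell2_inner Y (\<xi> x) (\<xi> x') * \<xi> x' y) (\<xi> x)"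
      by (simp add: p x mult_rank_one_rank_one \<xi>)
    finally have "zero_op Y (\<xi> x) = rank_one Y (\<lambda>y. ell2_inner Y (\<xi> x) (\<xi> x') * \<xi> x' y) (\<xi> x) (\<xi> x)"
      by simp
    then have "ell2_inner Y (\<xi> x) (\<xi> x') * \<xi> x' y = 0" for y
      using x by (auto simp: rank_one_apply \<xi> ell2_inner_self norm zero_op_def fun_eq_iff)
    then show ?thesis using nz[OF x(2)] False by auto
  qed (use x norm \<xi> in \<open>simp add: ell2_inner_self\<close>)
  show ?thesis
    by (rule that[of D \<xi>]) (use D \<xi> supp orth same_class diff_class in blast)+
qed

text \<open>
  Bessel's inequality for the basis vector at \<open>y\<close>. The projection \<open>h\<close> of that vector to the span of
  the \<open>\<xi> x\<close> has square norm \<open>s\<close>, the sum in question, and its own coordinate at \<open>y\<close> is \<open>s\<close> as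
  well. A coordinate is at most the norm, so \<open>s\<^sup>2 \<le> s\<close>.
\<close>

lemma orthonormal_coordinates_le_1:
  assumes F: "finite F" and \<xi>: "\<And>x. x \<in> F \<Longrightarrow> \<xi> x \<in> ell2 Y"
    and orth: "\<And>x x'. x \<in> F \<Longrightarrow> x' \<in> F \<Longrightarrow> ell2_inner Y (\<xi> x) (\<xi> x') = of_bool (x = x')"
  shows "(\<Sum>x\<in>F. (cmod (\<xi> x y))\<^sup>2) \<le> 1"
proof -
  define h where "h = (\<lambda>z. \<Sum>x\<in>F. cnj (\<xi> x y) * \<xi> x z)"
  define s where "s = (\<Sum>x\<in>F. (cmod (\<xi> x y))\<^sup>2)"
  have h: "h \<in> ell2 Y" unfolding h_def by (rule ell2_sum[OF \<xi>])
  have coeff: "ell2_inner Y (\<xi> x) h = \<xi> x y" if x: "x \<in> F" for x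
  proof -
    have "ell2_inner Y h (\<xi> x) = (\<Sum>x'\<in>F. cnj (\<xi> x' y) * ell2_inner Y (\<xi> x') (\<xi> x))"
      unfolding h_def by (rule ell2_inner_sum_left[OF \<xi> \<xi>[OF x]])
    also have "\<dots> = (\<Sum>x'\<in>F. if x' = x then cnj (\<xi> x' y) else 0)"
      by (intro sum.cong) (auto simp: orth x)
    also have "\<dots> = cnj (\<xi> x y)" using F x by simp
    finally show ?thesis using ell2_inner_cnj[of Y h "\<xi> x"] by simp
  qed
  have "ell2_inner Y h h = (\<Sum>x\<in>F. cnj (\<xi> x y) * ell2_inner Y (\<xi> x) h)"
    by (subst (1) h_def) (rule ell2_inner_sum_left[OF \<xi> h])
  also have "\<dots> = of_real s"
    unfolding s_def of_real_sum complex_norm_square by (intro sum.cong) (auto simp: coeff)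
  finally have hh: "(ell2_norm Y h)\<^sup>2 = s"
    unfolding ell2_inner_self[OF h] using of_real_eq_iff by blast
  have "h y = of_real s"
    unfolding h_def s_def of_real_sum complex_norm_square by (simp add: mult.commute)
  then have "\<bar>s\<bar> \<le> ell2_norm Y h" using coordinate_le_norm[OF h, of y] by simp
  then have "s\<^sup>2 \<le> s" unfolding hh[symmetric] using abs_le_square_iff[of s "ell2_norm Y h"] hh by simp
  then have "s \<le> 1" using hh by (cases "s \<le> 0") (auto simp: power2_eq_square)
  then show ?thesis by (simp add: s_def)
qed

text \<open>
  For finite \<open>D\<close>, sum all the squared coordinates of finitely many members of the orthonormal family
  in two ways: each member contributes \<open>1\<close>, and by Bessel's inequality each point contributes at most
  \<open>1\<close>. For infinite \<open>D\<close>, Bessel's inequality shows that at each point only countably many members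
  are nonzero, and every member is nonzero somewhere. So the family is a union of countable sets indexed by \<open>D\<close>, whose cardinality is at most
  that of \<open>D\<close>.
\<close>

lemma orthonormal_lepoll:
  assumes "D \<subseteq> Y" and \<xi>: "\<And>x. x \<in> C \<Longrightarrow> \<xi> x \<in> ell2 Y"
    and supp: "\<And>x y. x \<in> C \<Longrightarrow> y \<notin> D \<Longrightarrow> \<xi> x y = 0"
    and orth: "\<And>x x'. x \<in> C \<Longrightarrow> x' \<in> C \<Longrightarrow> ell2_inner Y (\<xi> x) (\<xi> x') = of_bool (x = x')"
  shows "C \<lesssim> D"
proof -
  have norm: "(ell2_norm Y (\<xi> x))\<^sup>2 = 1" if x: "x \<in> C" for x
    using orth[OF x x] ell2_inner_self[OF \<xi>[OF x]] by (metis of_bool_eq(2) of_real_eq_1_iff)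
  have bessel: "(\<Sum>x\<in>F. (cmod (\<xi> x y))\<^sup>2) \<le> 1" if "finite F" "F \<subseteq> C" for F y
    by (rule orthonormal_coordinates_le_1[where Y = Y]) (use that \<xi> orth in blast)+
  show ?thesis
  proof (cases "finite D")
    case True
    have card: "card F \<le> card D" if F: "finite F" "F \<subseteq> C" for F
    proof -
      have "real (card F) = (\<Sum>x\<in>F. (ell2_norm Y (\<xi> x))\<^sup>2)"
        using norm F by (simp add: subset_iff)
      also have "\<dots> = (\<Sum>x\<in>F. \<Sum>y\<in>D. (cmod (\<xi> x y))\<^sup>2)"
      proof (rule sum.cong[OF HOL.refl])
        fix x assume "x \<in> F"
        then show "(ell2_norm Y (\<xi> x))\<^sup>2 = (\<Sum>y\<in>D. (cmod (\<xi> x y))\<^sup>2)"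
          unfolding ell2_norm_square using supp F
          by (intro infsumI has_sum_finite_neutralI[OF True assms(1)]) auto
      qed
      also have "\<dots> = (\<Sum>y\<in>D. \<Sum>x\<in>F. (cmod (\<xi> x y))\<^sup>2)" by (rule sum.swap)
      also have "\<dots> \<le> (\<Sum>y\<in>D. 1)" by (intro sum_mono bessel F)
      finally show ?thesis by simp
    qed
    then have "finite C" using finite_if_finite_subsets_card_bdd[of C "card D"] by blast
    then show ?thesis using card[of C] True by (simp add: lepoll_iff_card_le)
  next
    case False
    define A where "A = (\<lambda>y. {x\<in>C. (cmod (\<xi> x y))\<^sup>2 \<noteq> 0})"
    have "countable (A y)" for y
    proof -
      have "(\<lambda>x. (cmod (\<xi> x y))\<^sup>2) summable_on C"
        by (rule nonneg_bdd_above_summable_on) (auto intro!: bdd_aboveI2 bessel)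
      then have "(\<lambda>x. norm ((cmod (\<xi> x y))\<^sup>2)) summable_on C" by simp
      then show ?thesis unfolding A_def by (rule abs_summable_countable)
    qed
    then have "A y \<lesssim> D" for y
      using False by (meson countable_def infinite_le_lepoll lepoll_def lepoll_trans subset_UNIV)
    then have "\<forall>y\<in>D. (card_of (A y), card_of D) \<in> ordLeq" by (simp add: lepoll_def card_of_ordLeq)
    then have "(card_of (\<Union>y\<in>D. A y), card_of D) \<in> ordLeq"
      using False by (intro card_of_UNION_ordLeq_infinite) (auto intro: card_of_mono1)
    then have "(\<Union>y\<in>D. A y) \<lesssim> D" by (simp add: lepoll_def card_of_ordLeq)
    moreover have "C \<subseteq> (\<Union>y\<in>D. A y)"
    proof
      fix x assume x: "x \<in> C"
      have "\<xi> x \<noteq> (\<lambda>_. 0)" using norm[OF x] by auto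
      then obtain y where "\<xi> x y \<noteq> 0" by (auto simp: fun_eq_iff)
      then show "x \<in> (\<Union>y\<in>D. A y)" using x supp[OF x, of y] by (auto simp: A_def)
    qed
    ultimately show ?thesis using lepoll_trans subset_imp_lepoll by blast
  qed
qed

lemma star_isomorphic_lepoll:
  assumes R: "equiv X R" and S: "equiv Y S"
    and iso: "star_isomorphic X Y (supp_ops X R) (supp_ops Y S)"
  shows "X // R \<lesssim> Y // S" and "\<And>C. C \<in> X // R \<Longrightarrow> \<exists>D\<in>Y // S. C \<lesssim> D"
proof -
  obtain D \<xi> where maps: "\<forall>x\<in>X. D x \<in> Y // S"
    "\<forall>x\<in>X. \<xi> x \<in> ell2 Y \<and> (\<forall>y. y \<notin> D x \<longrightarrow> \<xi> x y = 0)"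
    "\<forall>x\<in>X. \<forall>x'\<in>X. ell2_inner Y (\<xi> x) (\<xi> x') = of_bool (x = x')"
    "\<forall>x\<in>X. \<forall>x'\<in>X. D x = D x' \<longleftrightarrow> (x, x') \<in> R"
    by (rule star_isomorphism_class_map[OF R S iso])
  have D: "\<And>x. x \<in> X \<Longrightarrow> D x \<in> Y // S" using maps(1) by blast
  have eq: "\<And>x x'. x \<in> X \<Longrightarrow> x' \<in> X \<Longrightarrow> D x = D x' \<longleftrightarrow> (x, x') \<in> R" using maps(4) by blast
  have rep: "\<exists>x. x \<in> X \<and> x \<in> C" if "C \<in> X // R" for C
    using in_quotient_imp_non_empty[OF R that] class_subset[OF R that] by blast
  then obtain r where r: "\<And>C. C \<in> X // R \<Longrightarrow> r C \<in> X \<and> r C \<in> C" by metis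
  have "inj_on (\<lambda>C. D (r C)) (X // R)"
  proof (rule inj_onI)
    fix C C' assume C: "C \<in> X // R" "C' \<in> X // R" "D (r C) = D (r C')"
    then show "C = C'" using quotient_eqI[OF R C(1,2)] r eq by metis
  qed
  then show "X // R \<lesssim> Y // S" unfolding lepoll_def using D r by blast
  fix C assume C: "C \<in> X // R"
  have CX: "C \<subseteq> X" by (rule class_subset[OF R C])
  have "D x = D (r C)" if "x \<in> C" for x
    using that r[OF C] CX eq rel_iff_in_class[OF R C] by blast
  then have supp: "\<xi> x y = 0" if "x \<in> C" "y \<notin> D (r C)" for x y
    using that CX maps(2) by (metis subsetD)
  have "C \<lesssim> D (r C)"
    by (rule orthonormal_lepoll[OF class_subset[OF S D], of _ C \<xi>]) (use CX maps supp r[OF C] in blast)+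
  then show "\<exists>D\<in>Y // S. C \<lesssim> D" using D r[OF C] by blast
qed

section \<open>Unitary equivalence\<close>

lemma adjoint_mult:
  assumes S: "S \<in> bounded_ops Y Z" and T: "T \<in> bounded_ops X Y"
  shows "adjoint_op X Z (mult_op X S T) = mult_op Z (adjoint_op X Y T) (adjoint_op Y Z S)"
  by (rule adjoint_op_eqI)
    (simp add: is_adjoint_def mult_op_apply mult_op_bounded[OF adjoint_in[OF T] adjoint_in[OF S]]
      inner_adjoint[OF S op_in[OF T]] inner_adjoint[OF T _ op_in[OF adjoint_in[OF S]]])

text \<open>
  The isomorphism is conjugation by the unitary. Each identity is an equation of bounded operators
  and follows by inserting or cancelling $U^*U$ or $UU^*$.
\<close>

lemma unitarily_equivalent_imp_star_isomorphic:
  assumes A: "\<A> \<subseteq> bounded_ops X X" and equiv: "unitarily_equivalent X Y \<A> \<B>"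
  shows "star_isomorphic X Y \<A> \<B>"
proof -
  obtain U where U: "unitary_op X Y U"
    and B: "\<B> = (\<lambda>T. mult_op Y U (mult_op Y T (adjoint_op X Y U))) ` \<A>"
    using equiv by (auto simp: unitarily_equivalent_def)
  define V where "V = adjoint_op X Y U"
  define \<phi> where "\<phi> = (\<lambda>T. mult_op Y U (mult_op Y T V))"
  have Ub: "U \<in> bounded_ops X Y" using U by (simp add: unitary_op_def)
  then have Vb: "V \<in> bounded_ops Y X" unfolding V_def by (rule adjoint_in)
  have inverse: "mult_op X V U = id_op X" "mult_op Y U V = id_op Y"
    using U by (simp_all add: unitary_op_def V_def)
  have VU: "V (U f) = f" if "f \<in> ell2 X" for f
    using fun_cong[OF inverse(1), of f] that by (simp add: mult_op_apply id_op_def)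
  have UV: "U (V g) = g" if "g \<in> ell2 Y" for g
    using fun_cong[OF inverse(2), of g] that by (simp add: mult_op_apply id_op_def)
  have adjV: "adjoint_op Y X V = U" unfolding V_def by (rule adjoint_adjoint[OF Ub])
  have \<phi>_apply: "\<phi> T g = U (T (V g))" if "g \<in> ell2 Y" for T g
    using that by (simp add: \<phi>_def mult_op_apply)
  have \<phi>_bounded: "\<phi> T \<in> bounded_ops Y Y" if "T \<in> bounded_ops X X" for T
    unfolding \<phi>_def by (rule mult_op_bounded[OF Ub mult_op_bounded[OF that Vb]])
  note [simp] = op_in[OF Ub] op_in[OF Vb] VU UV \<phi>_apply
  have "inj_on \<phi> \<A>"
  proof (rule inj_onI)
    fix S T assume ST: "S \<in> \<A>" "T \<in> \<A>" "\<phi> S = \<phi> T"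
    note b = subsetD[OF A ST(1)] subsetD[OF A ST(2)]
    show "S = T"
    proof (rule op_eqI[OF b])
      fix f assume f: "f \<in> ell2 X"
      have "V (\<phi> S (U f)) = V (\<phi> T (U f))" using ST(3) by simp
      then show "S f = T f" using f op_in[OF b(1) f] op_in[OF b(2) f] by simp
    qed
  qed
  then have "bij_betw \<phi> \<A> \<B>" by (simp add: bij_betw_def B \<phi>_def V_def)
  moreover have "\<phi> (add_op X S T) = add_op Y (\<phi> S) (\<phi> T)" if "S \<in> \<A>" "T \<in> \<A>" for S T
  proof -
    note b = subsetD[OF A that(1)] subsetD[OF A that(2)]
    show ?thesis
      by (rule op_eqI[OF \<phi>_bounded[OF add_op_bounded[OF b]]
            add_op_bounded[OF \<phi>_bounded[OF b(1)] \<phi>_bounded[OF b(2)]]])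
        (simp add: add_op_def op_add[OF Ub] op_in[OF b(1)] op_in[OF b(2)])
  qed
  moreover have "\<phi> (scale_op X c T) = scale_op Y c (\<phi> T)" if "T \<in> \<A>" for c T
  proof -
    note b = subsetD[OF A that]
    show ?thesis
      by (rule op_eqI[OF \<phi>_bounded[OF scale_op_bounded[OF b]] scale_op_bounded[OF \<phi>_bounded[OF b]]])
        (simp add: scale_op_def op_scale[OF Ub] op_in[OF b])
  qed
  moreover have "\<phi> (mult_op X S T) = mult_op Y (\<phi> S) (\<phi> T)" if "S \<in> \<A>" "T \<in> \<A>" for S T
  proof -
    note b = subsetD[OF A that(1)] subsetD[OF A that(2)]
    show ?thesis
      by (rule op_eqI[OF \<phi>_bounded[OF mult_op_bounded[OF b]]
            mult_op_bounded[OF \<phi>_bounded[OF b(1)] \<phi>_bounded[OF b(2)]]])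
        (simp add: mult_op_apply op_in[OF b(2)])
  qed
  moreover have "\<phi> (adjoint_op X X T) = adjoint_op Y Y (\<phi> T)" if "T \<in> \<A>" for T
  proof -
    note b = subsetD[OF A that]
    have "adjoint_op Y Y (\<phi> T) = mult_op Y (mult_op X U (adjoint_op X X T)) V"
      unfolding \<phi>_def adjoint_mult[OF Ub mult_op_bounded[OF b Vb]] adjoint_mult[OF b Vb]
      by (simp add: adjV flip: V_def)
    also have "\<dots> = \<phi> (adjoint_op X X T)"
      by (rule op_eqI[OF mult_op_bounded[OF mult_op_bounded[OF Ub adjoint_in[OF b]] Vb]
            \<phi>_bounded[OF adjoint_in[OF b]]]) (simp add: mult_op_apply)
    finally show ?thesis by simp
  qed
  ultimately show ?thesis unfolding star_isomorphic_def by blast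
qed

text \<open>
  The map \<open>\<rho>\<close> goes from the new index set to the old one, so that it acts by composition. The
  value outside \<open>Y\<close> must be \<open>0\<close> for the image to be an element of \<open>ell2 Y\<close>.
\<close>

definition perm_op :: "'a set \<Rightarrow> 'b set \<Rightarrow> ('b \<Rightarrow> 'a) \<Rightarrow> ('a \<Rightarrow> complex) \<Rightarrow> ('b \<Rightarrow> complex)" where
  "perm_op X Y \<rho> = (\<lambda>f\<in>ell2 X. \<lambda>y. if y \<in> Y then f (\<rho> y) else 0)"

lemma perm_op_bounded:
  assumes \<rho>: "bij_betw \<rho> Y X"
  shows "perm_op X Y \<rho> \<in> bounded_ops X Y"
proof (rule bounded_opsI[where K = 1])
  fix f assume f: "f \<in> ell2 X"
  have "(\<lambda>y. (cmod (f (\<rho> y)))\<^sup>2) summable_on Y"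
    using summable_on_reindex_bij_betw[OF \<rho>, of "\<lambda>x. (cmod (f x))\<^sup>2"] ell2_summable[OF f] by simp
  then have "(\<lambda>y. (cmod (perm_op X Y \<rho> f y))\<^sup>2) summable_on Y"
    by (rule summable_on_cong[THEN iffD1, rotated]) (simp add: perm_op_def f)
  then show "perm_op X Y \<rho> f \<in> ell2 Y" by (intro ell2I) (simp_all add: perm_op_def f)
  have "(\<Sum>\<^sub>\<infinity>y\<in>Y. (cmod (perm_op X Y \<rho> f y))\<^sup>2) = (\<Sum>\<^sub>\<infinity>y\<in>Y. (cmod (f (\<rho> y)))\<^sup>2)"
    by (rule infsum_cong) (simp add: perm_op_def f)
  also have "\<dots> = (\<Sum>\<^sub>\<infinity>x\<in>X. (cmod (f x))\<^sup>2)"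
    by (rule infsum_reindex_bij_betw[OF \<rho>])
  finally show "ell2_norm Y (perm_op X Y \<rho> f) \<le> 1 * ell2_norm X f" by (simp add: ell2_norm_def)
qed (auto simp: perm_op_def ell2_add ell2_scale)

lemma perm_op_inverse:
  assumes \<rho>: "bij_betw \<rho> Y X" and f: "f \<in> ell2 X"
  shows "perm_op Y X (inv_into Y \<rho>) (perm_op X Y \<rho> f) = f"
proof
  fix x
  have "perm_op X Y \<rho> f \<in> ell2 Y" by (rule op_in[OF perm_op_bounded[OF \<rho>] f])
  then show "perm_op Y X (inv_into Y \<rho>) (perm_op X Y \<rho> f) x = f x"
    using f bij_betw_inv_into_right[OF \<rho>] bij_betwE[OF bij_betw_inv_into[OF \<rho>]] ell2_outside[OF f]
    by (auto simp: perm_op_def)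
qed

lemma perm_op_inverse':
  assumes \<rho>: "bij_betw \<rho> Y X" and g: "g \<in> ell2 Y"
  shows "perm_op X Y \<rho> (perm_op Y X (inv_into Y \<rho>) g) = g"
proof
  fix y
  have "perm_op Y X (inv_into Y \<rho>) g \<in> ell2 X"
    by (rule op_in[OF perm_op_bounded[OF bij_betw_inv_into[OF \<rho>]] g])
  then show "perm_op X Y \<rho> (perm_op Y X (inv_into Y \<rho>) g) y = g y"
    using g bij_betw_inv_into_left[OF \<rho>] bij_betwE[OF \<rho>] ell2_outside[OF g]
    by (auto simp: perm_op_def)
qed

lemma adjoint_perm_op:
  assumes \<rho>: "bij_betw \<rho> Y X"
  shows "adjoint_op X Y (perm_op X Y \<rho>) = perm_op Y X (inv_into Y \<rho>)"
proof (rule adjoint_op_eqI, unfold is_adjoint_def, intro conjI ballI)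
  show "perm_op Y X (inv_into Y \<rho>) \<in> bounded_ops Y X"
    by (rule perm_op_bounded[OF bij_betw_inv_into[OF \<rho>]])
  fix f g assume f: "f \<in> ell2 X" and g: "g \<in> ell2 Y"
  have "ell2_inner Y (perm_op X Y \<rho> f) g = (\<Sum>\<^sub>\<infinity>y\<in>Y. f (\<rho> y) * cnj (perm_op Y X (inv_into Y \<rho>) g (\<rho> y)))"
    unfolding ell2_inner_def
    by (rule infsum_cong) (use bij_betwE[OF \<rho>] bij_betw_inv_into_left[OF \<rho>] f g in \<open>simp add: perm_op_def\<close>)
  also have "\<dots> = ell2_inner X f (perm_op Y X (inv_into Y \<rho>) g)"
    unfolding ell2_inner_def
    by (rule infsum_reindex_bij_betw[OF \<rho>, where f = "\<lambda>x. f x * cnj (perm_op Y X (inv_into Y \<rho>) g x)"])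
  finally show "ell2_inner Y (perm_op X Y \<rho> f) g = ell2_inner X f (perm_op Y X (inv_into Y \<rho>) g)" .
qed

lemma perm_op_unitary:
  assumes \<rho>: "bij_betw \<rho> Y X"
  shows "unitary_op X Y (perm_op X Y \<rho>)"
  unfolding unitary_op_def adjoint_perm_op[OF \<rho>]
  by (auto simp: perm_op_bounded[OF \<rho>] mult_op_def compose_def id_op_def
      perm_op_inverse[OF \<rho>] perm_op_inverse'[OF \<rho>])

text \<open>
  Conjugation by a permutation of the basis merely relabels the matrix entries.
\<close>

lemma perm_op_conjugate_in_supp_ops:
  assumes \<rho>: "bij_betw \<rho> Y X"
    and rel: "\<And>y y'. y \<in> Y \<Longrightarrow> y' \<in> Y \<Longrightarrow> (y, y') \<in> S \<longleftrightarrow> (\<rho> y, \<rho> y') \<in> R"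
    and T: "T \<in> supp_ops X R"
  shows "mult_op Y (perm_op X Y \<rho>) (mult_op Y T (perm_op Y X (inv_into Y \<rho>))) \<in> supp_ops Y S"
  unfolding supp_ops_iff_matrix
proof (intro conjI ballI impI)
  let ?U = "perm_op X Y \<rho>" and ?V = "perm_op Y X (inv_into Y \<rho>)"
  note Tb = supp_ops_bounded[OF T] and Vb = perm_op_bounded[OF bij_betw_inv_into[OF \<rho>]]
  show "mult_op Y ?U (mult_op Y T ?V) \<in> bounded_ops Y Y"
    by (rule mult_op_bounded[OF perm_op_bounded[OF \<rho>] mult_op_bounded[OF Tb Vb]])
  fix y y' assume y: "y \<in> Y" "y' \<in> Y" "(y, y') \<notin> S"
  have \<rho>y: "\<rho> y \<in> X" "\<rho> y' \<in> X" using bij_betwE[OF \<rho>] y by auto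
  have "?V (ket y) x = ket (\<rho> y) x" for x
    using y \<rho>y bij_betw_inv_into_left[OF \<rho>] bij_betw_inv_into_right[OF \<rho>]
    by (simp add: perm_op_def ell2_ket) (auto simp: ket_def)
  then have "?V (ket y) = ket (\<rho> y)" by blast
  then show "mult_op Y ?U (mult_op Y T ?V) (ket y) y' = 0"
    using y \<rho>y supp_ops_matrix[OF T \<rho>y] rel[OF y(1,2)]
    by (simp add: mult_op_apply ell2_ket) (simp add: perm_op_def op_in[OF Tb] ell2_ket)
qed

lemma relation_isomorphism_imp_unitarily_equivalent:
  assumes \<rho>: "bij_betw \<rho> Y X"
    and rel: "\<And>y y'. y \<in> Y \<Longrightarrow> y' \<in> Y \<Longrightarrow> (y, y') \<in> S \<longleftrightarrow> (\<rho> y, \<rho> y') \<in> R"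
  shows "unitarily_equivalent X Y (supp_ops X R) (supp_ops Y S)"
proof -
  let ?U = "perm_op X Y \<rho>" and ?V = "perm_op Y X (inv_into Y \<rho>)"
  let ?\<phi> = "\<lambda>T. mult_op Y ?U (mult_op Y T ?V)"
  have \<rho>': "bij_betw (inv_into Y \<rho>) X Y" by (rule bij_betw_inv_into[OF \<rho>])
  have inv_inv: "perm_op X Y (inv_into X (inv_into Y \<rho>)) = ?U"
    by (auto simp: perm_op_def inv_into_inv_into_eq[OF \<rho>] fun_eq_iff restrict_def)
  have "T \<in> ?\<phi> ` supp_ops X R" if T: "T \<in> supp_ops Y S" for T
  proof
    let ?T = "mult_op X ?V (mult_op X T ?U)"
    have rel': "(x, x') \<in> R \<longleftrightarrow> (inv_into Y \<rho> x, inv_into Y \<rho> x') \<in> S" if "x \<in> X" "x' \<in> X" for x x'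
      using rel[of "inv_into Y \<rho> x" "inv_into Y \<rho> x'"] bij_betwE[OF \<rho>'] that
        bij_betw_inv_into_right[OF \<rho>] by simp
    show T': "?T \<in> supp_ops X R"
      using perm_op_conjugate_in_supp_ops[OF \<rho>' rel' T] by (simp add: inv_inv)
    have b: "?\<phi> ?T \<in> bounded_ops Y Y"
      by (rule supp_ops_bounded[OF perm_op_conjugate_in_supp_ops[OF \<rho> rel T']])
    note Tb = supp_ops_bounded[OF T]
    show "T = ?\<phi> ?T"
      by (rule op_eqI[OF Tb b]) (simp add: mult_op_apply op_in[OF perm_op_bounded[OF \<rho>']]
          op_in[OF Tb] perm_op_inverse'[OF \<rho>])
  qed
  then have "supp_ops Y S = ?\<phi> ` supp_ops X R"
    using perm_op_conjugate_in_supp_ops[OF \<rho> rel] by blast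
  then show ?thesis
    unfolding unitarily_equivalent_def using perm_op_unitary[OF \<rho>] adjoint_perm_op[OF \<rho>] by metis
qed

section \<open>Equivalence relations and left cosets\<close>

text \<open>
  A matching of the classes together with bijections between matched classes glues to a bijection of
  the whole sets. It respects the relations because different classes are disjoint.
\<close>

lemma equiv_isomorphism_from_classes:
  assumes R: "equiv X R" and S: "equiv Y S"
    and b: "bij_betw b (Y // S) (X // R)" and sizes: "\<And>D. D \<in> Y // S \<Longrightarrow> D \<approx> b D"
  obtains \<rho> where "bij_betw \<rho> Y X"
    "\<forall>y\<in>Y. \<forall>y'\<in>Y. (y, y') \<in> S \<longleftrightarrow> (\<rho> y, \<rho> y') \<in> R"
proof -
  obtain f where f: "\<And>D. D \<in> Y // S \<Longrightarrow> bij_betw (f D) D (b D)"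
    using sizes unfolding eqpoll_def by metis
  define \<rho> where "\<rho> = (\<lambda>y. f (S `` {y}) y)"
  have bD: "b D \<in> X // R" if "D \<in> Y // S" for D using b that by (auto simp: bij_betw_def)
  have class_eq: "S `` {y} = D" if "D \<in> Y // S" "y \<in> D" for D y
    using that rel_iff_in_class[OF S that] by blast
  have \<rho>: "\<rho> y = f D y" "\<rho> y \<in> b D" if "D \<in> Y // S" "y \<in> D" for D y
    using class_eq[OF that] f[OF that(1)] that(2) by (auto simp: \<rho>_def bij_betw_def)
  have in_class: "S `` {y} \<in> Y // S" "y \<in> S `` {y}" if "y \<in> Y" for y
    using that equiv_class_self[OF S] by (auto intro: quotientI)
  have rel: "(y, y') \<in> S \<longleftrightarrow> (\<rho> y, \<rho> y') \<in> R" if y: "y \<in> Y" "y' \<in> Y" for y y'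
  proof -
    note c = in_class[OF y(1)] and c' = in_class[OF y(2)]
    have "(\<rho> y, \<rho> y') \<in> R \<longleftrightarrow> \<rho> y' \<in> b (S `` {y})"
      by (rule rel_iff_in_class[OF R bD[OF c(1)] \<rho>(2)[OF c]])
    also have "\<dots> \<longleftrightarrow> b (S `` {y}) = b (S `` {y'})"
      using quotient_disj[OF R bD[OF c(1)] bD[OF c'(1)]] \<rho>(2)[OF c'] by blast
    also have "\<dots> \<longleftrightarrow> S `` {y} = S `` {y'}"
      using b c c' by (auto simp: bij_betw_def inj_on_def)
    also have "\<dots> \<longleftrightarrow> (y, y') \<in> S" by (rule eq_equiv_class_iff[OF S y])
    finally show ?thesis by blast
  qed
  have "inj_on \<rho> Y"
  proof (rule inj_onI)
    fix y y' assume y: "y \<in> Y" "y' \<in> Y" "\<rho> y = \<rho> y'"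
    note c = in_class[OF y(1)]
    have "\<rho> y \<in> X" using \<rho>(2)[OF c] class_subset[OF R bD[OF c(1)]] by blast
    then have "(\<rho> y, \<rho> y') \<in> R" using R y(3) by (simp add: equiv_def refl_on_def)
    then have y': "y' \<in> S `` {y}" using rel[OF y(1,2)] by blast
    show "y = y'"
      using f[OF c(1)] \<rho>(1)[OF c] \<rho>(1)[OF c(1) y'] c(2) y' y(3) by (auto simp: bij_betw_def inj_on_def)
  qed
  moreover have "\<rho> ` Y = X"
  proof
    show "\<rho> ` Y \<subseteq> X" using \<rho>(2)[OF in_class] class_subset[OF R bD[OF in_class(1)]] by blast
    show "X \<subseteq> \<rho> ` Y"
    proof
      fix x assume x: "x \<in> X"
      have "R `` {x} \<in> b ` (Y // S)" using b x by (auto simp: bij_betw_def intro: quotientI)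
      then obtain D where D: "D \<in> Y // S" "b D = R `` {x}" by blast
      then have "x \<in> f D ` D" using f[OF D(1)] equiv_class_self[OF R x] by (simp add: bij_betw_def)
      then obtain y where "y \<in> D" "x = f D y" by blast
      then show "x \<in> \<rho> ` Y" using \<rho>(1)[OF D(1)] class_subset[OF S D(1)] by (metis imageI subsetD)
    qed
  qed
  ultimately show ?thesis using that rel by (auto simp: bij_betw_def)
qed

context group
begin

lemma star_set_iff_l_coset:
  assumes "subgroup H G" "g \<in> carrier G"
  shows "(g, h) \<in> star_set G H \<longleftrightarrow> h \<in> g <# H"
proof -
  interpret subgroup H G by fact
  show ?thesis
    using assms(2) subset lcos_module_imp[OF is_group assms(2)] lcos_module_rev[OF is_group assms(2)]
      elemlcos_carrier[OF is_group assms(2)]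
    by (auto simp: star_set_def)
qed

lemma equiv_star_set:
  assumes "subgroup H G"
  shows "equiv (carrier G) (star_set G H)"
proof -
  interpret subgroup H G by fact
  have eq: "inv g \<otimes> h = inv (inv h \<otimes> g)" "inv g \<otimes> k = (inv g \<otimes> h) \<otimes> (inv h \<otimes> k)"
    if "g \<in> carrier G" "h \<in> carrier G" "k \<in> carrier G" for g h k
  proof -
    show "inv g \<otimes> h = inv (inv h \<otimes> g)" using that by (simp add: inv_mult_group)
    have "h \<otimes> (inv h \<otimes> k) = k" using that by (simp flip: m_assoc)
    then show "inv g \<otimes> k = (inv g \<otimes> h) \<otimes> (inv h \<otimes> k)" using that by (simp add: m_assoc)
  qed
  show ?thesis
  proof (rule equivI)
    show "sym (star_set G H)"
      by (rule symI) (auto simp: star_set_def, metis eq(1) m_inv_closed)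
    show "trans (star_set G H)"
      by (rule transI) (auto simp: star_set_def, metis eq(2) m_closed)
  qed (auto simp: star_set_def refl_on_def)
qed

lemma quotient_star_set:
  assumes "subgroup H G"
  shows "carrier G // star_set G H = lcosets H"
proof -
  have "star_set G H `` {g} = g <# H" if "g \<in> carrier G" for g
    using star_set_iff_l_coset[OF assms that] by blast
  then show ?thesis by (simp add: quotient_def LCOSETS_def)
qed

lemma subgroup_in_lcosets:
  assumes "subgroup H G"
  shows "H \<in> lcosets H"
  using lcos_mult_one[OF subgroup.subset[OF assms]] by (force simp: LCOSETS_def)

lemma lcoset_eqpoll:
  assumes H: "subgroup H G" and C: "C \<in> lcosets H"
  shows "C \<approx> H"
proof -
  obtain g where g: "g \<in> carrier G" "C = g <# H" using C by (auto simp: LCOSETS_def)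
  have "inj_on ((\<otimes>) g) H" using inj_on_g'[OF subgroup.subset[OF H] g(1)] .
  moreover have "C = (\<otimes>) g ` H" by (auto simp: g l_coset_def)
  ultimately show ?thesis using inj_on_image_eqpoll_self by blast
qed

end

theorem theorem3p4:
  fixes G1 :: "('a, 'm) monoid_scheme" and G2 :: "('b, 'n) monoid_scheme"
    and H1 :: "'a set" and H2 :: "'b set"
  assumes "group G1" and "group G2" and "subgroup H1 G1" and "subgroup H2 G2"
  shows "(unitarily_equivalent (carrier G1) (carrier G2)
            (supp_ops (carrier G1) (star_set G1 H1)) (supp_ops (carrier G2) (star_set G2 H2))
          \<longleftrightarrow> star_isomorphic (carrier G1) (carrier G2)
            (supp_ops (carrier G1) (star_set G1 H1)) (supp_ops (carrier G2) (star_set G2 H2)))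
       \<and> (star_isomorphic (carrier G1) (carrier G2)
            (supp_ops (carrier G1) (star_set G1 H1)) (supp_ops (carrier G2) (star_set G2 H2))
          \<longleftrightarrow> H1 \<approx> H2 \<and> lcosets\<^bsub>G1\<^esub> H1 \<approx> lcosets\<^bsub>G2\<^esub> H2)"
proof -
  let ?X = "carrier G1" and ?Y = "carrier G2"
  let ?R = "star_set G1 H1" and ?S = "star_set G2 H2"
  let ?ue = "unitarily_equivalent ?X ?Y (supp_ops ?X ?R) (supp_ops ?Y ?S)"
  let ?si = "star_isomorphic ?X ?Y (supp_ops ?X ?R) (supp_ops ?Y ?S)"
  note R = group.equiv_star_set[OF assms(1,3)] and S = group.equiv_star_set[OF assms(2,4)]
  note quot = group.quotient_star_set[OF assms(1,3)] group.quotient_star_set[OF assms(2,4)]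
  note size = group.lcoset_eqpoll[OF assms(1,3)] group.lcoset_eqpoll[OF assms(2,4)]
  have "?ue \<Longrightarrow> ?si"
    by (rule unitarily_equivalent_imp_star_isomorphic) (auto intro: supp_ops_bounded)
  moreover have "H1 \<approx> H2 \<and> lcosets\<^bsub>G1\<^esub> H1 \<approx> lcosets\<^bsub>G2\<^esub> H2" if iso: ?si
  proof -
    note iso' = star_isomorphic_sym[OF R iso]
    note le = star_isomorphic_lepoll[OF R S iso, unfolded quot]
    note ge = star_isomorphic_lepoll[OF S R iso', unfolded quot]
    note coset = group.subgroup_in_lcosets[OF assms(1,3)] group.subgroup_in_lcosets[OF assms(2,4)]
    have "H1 \<lesssim> H2"
      using le(2)[OF coset(1)] size(2) by (meson lepoll_trans2)
    moreover have "H2 \<lesssim> H1"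
      using ge(2)[OF coset(2)] size(1) by (meson lepoll_trans2)
    ultimately show ?thesis by (simp add: lepoll_antisym le(1) ge(1))
  qed
  moreover have ?ue if same: "H1 \<approx> H2 \<and> lcosets\<^bsub>G1\<^esub> H1 \<approx> lcosets\<^bsub>G2\<^esub> H2"
  proof -
    have "?Y // ?S \<approx> ?X // ?R" unfolding quot using same by (auto intro: eqpoll_sym)
    then obtain b where b: "bij_betw b (?Y // ?S) (?X // ?R)" by (auto simp: eqpoll_def)
    have "D \<approx> b D" if D: "D \<in> ?Y // ?S" for D
    proof -
      have "b D \<in> lcosets\<^bsub>G1\<^esub> H1" "D \<in> lcosets\<^bsub>G2\<^esub> H2"
        using bij_betwE[OF b] D by (simp_all add: quot)
      then have "D \<approx> H2" "H1 \<approx> b D" using size by (auto intro: eqpoll_sym)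
      moreover have "H2 \<approx> H1" using same by (auto intro: eqpoll_sym)
      ultimately show ?thesis by (meson eqpoll_trans)
    qed
    then obtain \<rho> where "bij_betw \<rho> ?Y ?X"
      "\<forall>y\<in>?Y. \<forall>y'\<in>?Y. (y, y') \<in> ?S \<longleftrightarrow> (\<rho> y, \<rho> y') \<in> ?R"
      by (rule equiv_isomorphism_from_classes[OF R S b])
    then show ?thesis by (intro relation_isomorphism_imp_unitarily_equivalent) auto
  qed
  ultimately show ?thesis by blast
qed

end
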